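(* Let $K$ be a field and let $R=K[x^2,x^n]\subseteq K[x]$, where $n\ge 3$ is an odd rational integer. Let $I$ be a nonzero ideal of $R$ and let $f$ be the smallest positive odd rational integer such that $x^f I\subseteq I$. Then the following hold. (i) $\varrho(I)=K[x^2]+K[x]x^{f-1}$. (ii) $\mathrm{Fitt}_1(I)=(R:\varrho(I))=K[x^2]x^{n-f}+K[x]x^{n-1}$. (iii) The ring $R/\mathrm{Fitt}_1(I)$ is isomorphic to $K[x^2]/K[x^2]x^{n-f}$. (iv) The group $\mathrm{SL}_k(R)$ acts transitively on $V_k(I)$ for every $k>2$.
   Context: $K(R)$ is the field of fractions of $R$. $\varrho(I)=\{y\in K(R): yI\subseteq I\}$ is the ring of multipliers of $I$. For a ring $S$ with $R\subseteq S\subseteq K(R)$, $(R:S)=\{r\in R: rS\subseteq R\}$. Fitting ideals: if $F\xrightarrow{\varphi} G\to M\to 0$ is exact with $F,G$ free $R$-modules and $G$ of finite rank $g$, then $\mathrm{Fitt}_i(M)$ is the ideal generated by the $(g-i)\times(g-i)$ minors of a matrix of $\varphi$ (the ideal of $0\times 0$ minors being $R$). $V_k(I)$ is the set of $k$-tuples of elements of $I$ that generate $I$; $\mathrm{SL}_k(R)$ acts on it by right multiplication of row vectors by matrices. *)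

theory Defs
  imports
    "HOL-Algebra.Group_Action"
    "HOL-Algebra.Generated_Rings"
    "HOL-Algebra.QuotRing"
    "HOL-Algebra.Algebraic_Closure_Type"
    "Jordan_Normal_Form.Determinant"
begin

text \<open>Rings are given by their carrier sets, as subrings of an ambient ring or field that is a type.\<close>

definition ring_on :: "'r::comm_ring_1 set \<Rightarrow> 'r ring" where
  "ring_on S = ring_of_type_algebra\<lparr>carrier := S\<rparr>"

definition submodule_on :: "'r::comm_ring_1 set \<Rightarrow> ('r, 'r) module" where
  "submodule_on M =
    \<lparr>carrier = M, monoid.mult = (*), one = 1, zero = 0, add = (+), module.smult = (*)\<rparr>"

definition fraction_field :: "'l::field set \<Rightarrow> 'l set" where
  "fraction_field R = {a / b | a b. a \<in> R \<and> b \<in> R \<and> b \<noteq> 0}"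

definition multiplier_ring :: "'l::field set \<Rightarrow> 'l set \<Rightarrow> 'l set" where
  "multiplier_ring R I = {y \<in> fraction_field R. \<forall>z\<in>I. y * z \<in> I}"

definition conductor :: "'l::field set \<Rightarrow> 'l set \<Rightarrow> 'l set" where
  "conductor R S = {r \<in> R. \<forall>s\<in>S. r * s \<in> R}"

definition free_module :: "'r set \<Rightarrow> nat \<Rightarrow> 'r vec set" where
  "free_module R g = {v \<in> carrier_vec g. set\<^sub>v v \<subseteq> R}"

text \<open>An exact sequence \<open>F \<rightarrow> G \<rightarrow> M \<rightarrow> 0\<close> with \<open>G = R\<^sup>g\<close> and \<open>F\<close> free on the (possibly infinite)
  set \<open>B\<close>: the standard basis of \<open>G\<close> is mapped to \<open>e 0, \<dots>, e (g - 1)\<close>, and \<open>\<phi> b\<close> is the image in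
  \<open>G\<close> of the basis element \<open>b\<close> of \<open>F\<close>, i.e. the column with index \<open>b\<close> of the matrix.\<close>

definition free_presentation ::
  "'r::comm_ring_1 set \<Rightarrow> ('r, 'm) module \<Rightarrow> nat \<Rightarrow> (nat \<Rightarrow> 'm) \<Rightarrow> 'b set \<Rightarrow> ('b \<Rightarrow> 'r vec) \<Rightarrow> bool"
where
  "free_presentation R M g e B \<phi> \<longleftrightarrow>
     e \<in> {..<g} \<rightarrow> carrier M \<and>
     \<phi> \<in> B \<rightarrow> free_module R g \<and>
     (\<forall>m\<in>carrier M. \<exists>c\<in>free_module R g. m = (\<Oplus>\<^bsub>M\<^esub>i\<in>{..<g}. c $ i \<odot>\<^bsub>M\<^esub> e i)) \<and>
     (\<forall>c\<in>free_module R g.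
        (\<Oplus>\<^bsub>M\<^esub>i\<in>{..<g}. c $ i \<odot>\<^bsub>M\<^esub> e i) = \<zero>\<^bsub>M\<^esub> \<longleftrightarrow>
        (\<exists>T d. finite T \<and> T \<subseteq> B \<and> d \<in> T \<rightarrow> R \<and> c = vec g (\<lambda>i. \<Sum>b\<in>T. d b * \<phi> b $ i)))"

definition minors :: "nat \<Rightarrow> nat \<Rightarrow> 'b set \<Rightarrow> ('b \<Rightarrow> 'r::comm_ring_1 vec) \<Rightarrow> 'r set" where
  "minors m g B \<phi> =
     {det (mat m m (\<lambda>(p, q). \<phi> (cols q) $ rows p)) | rows cols.
        inj_on rows {..<m} \<and> rows ` {..<m} \<subseteq> {..<g} \<and>
        inj_on cols {..<m} \<and> cols ` {..<m} \<subseteq> B}"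

text \<open>The ideal does not depend on the presentation, so the description determines it as soon as
  \<open>M\<close> is finitely generated. Taking the basis of \<open>F\<close> among the elements of the type of vectors is no
  restriction: a repeated column changes neither the image of \<open>\<phi>\<close> nor the ideal of minors. For
  \<open>i \<ge> g\<close> the truncated difference \<open>g - i\<close> is \<open>0\<close>, and the \<open>0 \<times> 0\<close> minor is \<open>1\<close>.\<close>

definition fitting_ideal :: "'r::comm_ring_1 set \<Rightarrow> nat \<Rightarrow> ('r, 'm) module \<Rightarrow> 'r set" where
  "fitting_ideal R i M =
     (THE J. \<exists>g e (B :: 'r vec set) \<phi>. free_presentation R M g e B \<phi> \<and>
        J = Idl\<^bsub>ring_on R\<^esub> (minors (g - i) g B \<phi>))"

definition generating_tuples :: "'r::comm_ring_1 set \<Rightarrow> nat \<Rightarrow> 'r set \<Rightarrow> 'r vec set" where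
  "generating_tuples R k I =
     {v \<in> carrier_vec k. set\<^sub>v v \<subseteq> I \<and> Idl\<^bsub>ring_on R\<^esub> (set\<^sub>v v) = I}"

definition SL :: "nat \<Rightarrow> 'r::comm_ring_1 set \<Rightarrow> 'r mat monoid" where
  "SL k R = \<lparr>carrier = {A \<in> carrier_mat k k. elements_mat A \<subseteq> R \<and> det A = 1},
             monoid.mult = (*), one = 1\<^sub>m k\<rparr>"

definition row_vec_mult :: "'r::comm_ring_1 vec \<Rightarrow> 'r mat \<Rightarrow> 'r vec" where
  "row_vec_mult v A = vec (dim_col A) (\<lambda>j. v \<bullet> col A j)"

text \<open>The library has left actions only; a right action of \<open>G\<close> is a left action of the opposite
  group. Elements of the permutation group of \<open>E\<close> are extensional, hence the restriction to \<open>E\<close>.\<close>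

definition transitive_right_action ::
  "'g monoid \<Rightarrow> 'e set \<Rightarrow> ('e \<Rightarrow> 'g \<Rightarrow> 'e) \<Rightarrow> bool" where
  "transitive_right_action G E act \<longleftrightarrow>
     transitive_action (G\<lparr>monoid.mult := \<lambda>a b. b \<otimes>\<^bsub>G\<^esub> a\<rparr>) E (\<lambda>a. \<lambda>x\<in>E. act x a)"

text \<open>The field \<open>K\<close> is the type \<open>'a\<close>, and everything takes place in \<open>K(x)\<close>, the type \<open>'a poly fract\<close>.\<close>

definition indet :: "'a::field poly fract" where
  "indet = to_fract [:0, 1:]"

text \<open>\<open>adjoin S\<close> is \<open>K[S]\<close>, the \<open>K\<close>-subalgebra of \<open>K(x)\<close> generated by \<open>S\<close>.\<close>

definition adjoin :: "'a::field poly fract set \<Rightarrow> 'a poly fract set" where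
  "adjoin S = generate_ring ring_of_type_algebra (range (\<lambda>c. to_fract [:c:]) \<union> S)"

end

theory Submission
  imports Defs
begin

text \<open>The ring \<open>R\<close> is the order \<open>K[x\<^sup>2] + K[x\<^sup>2] x\<^sup>n\<close> over the principal ideal domain
  \<open>A = K[x\<^sup>2]\<close>, and \<open>I\<close> is free of rank \<open>2\<close> over \<open>A\<close>, say with basis \<open>e0, e1\<close>. The multipliers
  of \<open>I\<close> are integral over \<open>A\<close>, so they form a ring \<open>A + q A x\<close> in which \<open>x\<^sup>n\<close> lies; hence \<open>q\<close> is a
  power of \<open>x\<^sup>2\<close>. If \<open>x\<^sup>f\<close> acts on \<open>e0, e1\<close> by the matrix \<open>((p, q), (r, s))\<close>, then \<open>q\<close>, \<open>r\<close> and
  \<open>p - s\<close> are coprime, since a common factor would enlarge the multiplier ring. The relations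
  \<open>(c (x\<^sup>f - p), - c q)\<close> and \<open>(- c r, c (x\<^sup>f - s))\<close>, with \<open>c\<close> in the conductor, then show that the
  entries of the relations of \<open>e0, e1\<close> generate the conductor. Since \<open>fitting_ideal\<close> quantifies
  over all presentations, Fitting's independence lemma is needed as well. For the transitivity, a
  \<open>2 \<times> k\<close> coordinate matrix over \<open>A\<close> with \<open>k > 2\<close> can be reduced to one with a zero column, and
  the free place allows one to insert \<open>e0\<close> and then \<open>e1\<close>.\<close>

section \<open>Subrings given by their carrier\<close>

text \<open>\<open>R\<close> need not be a principal ideal domain, so two kinds of coefficients are
  kept apart: matrices, gcds and division with remainder live over A, whereas relations, minors and
  the special linear group live over \<open>R\<close>. Ideals of minors are not computed from
  generators but compared through the ideals \<open>J\<close> containing them, because the assertion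
  that all minors lie in \<open>J\<close> passes easily from one presentation to another. That every
  relation u e0 + v e1 = 0 has entries in the conductor follows by multiplying it by x^f and
  eliminating: u x^f and v x^f become A-combinations of u and v, so they stay in \<open>R\<close>.
  The isomorphism of (iii) is induced by sending a + b x^n, with a and b in A, to a modulo x^(n-f);
  this is multiplicative because x^(2n) is a multiple of x^(n-f) in A, and its kernel is the
  conductor. The number f enters because the multiplier ring is A + A x^m for one odd m, and an odd
  power x^k lies in it exactly when m \<le> k.\<close>

locale unital_subring =
  fixes R :: "'r::comm_ring_1 set"
  assumes one_mem: "1 \<in> R"
    and diff_mem: "\<lbrakk>a \<in> R; b \<in> R\<rbrakk> \<Longrightarrow> a - b \<in> R"
    and mult_mem: "\<lbrakk>a \<in> R; b \<in> R\<rbrakk> \<Longrightarrow> a * b \<in> R"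
begin

lemma zero_mem: "0 \<in> R"
  using diff_mem[OF one_mem one_mem] by simp

lemma uminus_mem: "a \<in> R \<Longrightarrow> - a \<in> R"
  using diff_mem[OF zero_mem] by fastforce

lemma add_mem: "a \<in> R \<Longrightarrow> b \<in> R \<Longrightarrow> a + b \<in> R"
  using diff_mem[OF _ uminus_mem] by fastforce

lemma sum_mem: "(\<And>i. i \<in> S \<Longrightarrow> f i \<in> R) \<Longrightarrow> sum f S \<in> R"
  by (induction S rule: infinite_finite_induct) (auto intro: zero_mem add_mem)

lemma power_mem: "a \<in> R \<Longrightarrow> a ^ k \<in> R"
  by (induction k) (auto intro: one_mem mult_mem)

lemmas ring_closed = zero_mem one_mem uminus_mem add_mem diff_mem mult_mem sum_mem power_mem

lemma ring_on_simps [simp]: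
  "carrier (ring_on S) = S" "x \<otimes>\<^bsub>ring_on S\<^esub> y = x * y" "x \<oplus>\<^bsub>ring_on S\<^esub> y = x + y"
  "\<one>\<^bsub>ring_on S\<^esub> = 1" "\<zero>\<^bsub>ring_on S\<^esub> = 0"
  by (simp_all add: ring_on_def ring_of_type_algebra_def)

lemma cring_ring_on: "cring (ring_on R)"
proof -
  have "\<exists>y\<in>R. y + x = 0" if "x \<in> R" for x
    using uminus_mem[OF that] by (intro bexI[of _ "- x"]) auto
  then show ?thesis
    by (intro cringI abelian_groupI comm_monoidI)
      (auto intro: ring_closed simp: algebra_simps)
qed

text \<open>Negatives come from multiplication by -1, which lies in \<open>R\<close>; this leaves
  four conditions that can be checked by plain arithmetic in the ambient ring.\<close>

lemma ideal_ring_on_iff: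
  "ideal J (ring_on R) \<longleftrightarrow>
     J \<subseteq> R \<and> 0 \<in> J \<and> (\<forall>a\<in>J. \<forall>b\<in>J. a + b \<in> J) \<and> (\<forall>r\<in>R. \<forall>a\<in>J. r * a \<in> J)"
  (is "?l \<longleftrightarrow> ?r")
proof
  interpret cring "ring_on R" by (rule cring_ring_on)
  assume ?l
  then interpret J: ideal J "ring_on R" .
  show ?r
    using J.a_subset J.zero_closed J.a_closed J.I_l_closed by auto
next
  interpret cring "ring_on R" by (rule cring_ring_on)
  assume r: ?r
  have inv: "\<ominus>\<^bsub>ring_on R\<^esub> a = - a" if "a \<in> R" for a
    using that by (intro minus_equality) (auto simp: ring_closed)
  have neg: "- a \<in> J" if "a \<in> J" for a
  proof -
    have "(- 1) * a \<in> J" using r that uminus_mem[OF one_mem] by blast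
    then show ?thesis by simp
  qed
  show ?l
  proof (rule idealI)
    show "ring (ring_on R)" by (rule ring_axioms)
    show "subgroup J (add_monoid (ring_on R))"
      by (rule add.subgroupI) (use r inv neg in \<open>auto simp: a_inv_def[symmetric]\<close>)
    fix a x assume "a \<in> J" "x \<in> carrier (ring_on R)"
    then have "x * a \<in> J" using r by simp
    then show "x \<otimes>\<^bsub>ring_on R\<^esub> a \<in> J" "a \<otimes>\<^bsub>ring_on R\<^esub> x \<in> J"
      by (simp_all add: mult.commute)
  qed
qed

lemma ideal_subset: "ideal J (ring_on R) \<Longrightarrow> J \<subseteq> R"
  by (simp add: ideal_ring_on_iff)

lemma ideal_zero: "ideal J (ring_on R) \<Longrightarrow> 0 \<in> J"
  by (simp add: ideal_ring_on_iff)

lemma ideal_add: "ideal J (ring_on R) \<Longrightarrow> a \<in> J \<Longrightarrow> b \<in> J \<Longrightarrow> a + b \<in> J"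
  by (simp add: ideal_ring_on_iff)

lemma ideal_mult: "ideal J (ring_on R) \<Longrightarrow> r \<in> R \<Longrightarrow> a \<in> J \<Longrightarrow> r * a \<in> J"
  by (simp add: ideal_ring_on_iff)

lemma ideal_uminus: "ideal J (ring_on R) \<Longrightarrow> a \<in> J \<Longrightarrow> - a \<in> J"
  using ideal_mult[of J "- 1" a] uminus_mem[OF one_mem] by simp

lemma ideal_diff: "ideal J (ring_on R) \<Longrightarrow> a \<in> J \<Longrightarrow> b \<in> J \<Longrightarrow> a - b \<in> J"
  using ideal_add[of J a "- b"] ideal_uminus[of J b] by simp

lemma ideal_sum:
  "ideal J (ring_on R) \<Longrightarrow> (\<And>i. i \<in> S \<Longrightarrow> f i \<in> J) \<Longrightarrow> sum f S \<in> J"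
  by (induction S rule: infinite_finite_induct) (auto intro: ideal_zero ideal_add)

text \<open>An ideal is determined by the ideals above it. This is the device that lets a Fitting
  ideal be identified by testing its generators against every \<open>J\<close>.\<close>

lemma genideal_ring_on_eqI:
  assumes F: "ideal F (ring_on R)"
    and least: "\<And>J. ideal J (ring_on R) \<Longrightarrow> A \<subseteq> J \<longleftrightarrow> F \<subseteq> J"
  shows "genideal (ring_on R) A = F"
proof -
  interpret cring "ring_on R" by (rule cring_ring_on)
  have A: "A \<subseteq> F" using least[OF F] by simp
  then have "A \<subseteq> carrier (ring_on R)" using ideal_subset[OF F] by simp
  then have "F \<subseteq> genideal (ring_on R) A"
    using least[OF genideal_ideal] genideal_self by blast
  with genideal_minimal[OF F A] show ?thesis by blast
qed

end

section \<open>Minors as multilinear functions of the columns\<close>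

text \<open>Columns are functions on an arbitrary index type rather than vectors, so that generators
  may be indexed by a disjoint sum and a single column can be exchanged by function update. Rows and
  columns may repeat.\<close>

definition minor_det ::
  "nat \<Rightarrow> (nat \<Rightarrow> 'i \<Rightarrow> 'r::comm_ring_1) \<Rightarrow> (nat \<Rightarrow> 'i) \<Rightarrow> 'r" where
  "minor_det m w \<rho> = det (mat m m (\<lambda>(p, q). w q (\<rho> p)))"

text \<open>The increasing enumeration of the indices other than \<open>k\<close>, in the numbering
  that \<open>mat_delete\<close> uses.\<close>

definition skip :: "nat \<Rightarrow> nat \<Rightarrow> nat" where
  "skip k q = (if q < k then q else Suc q)"

lemma skip_neq: "skip k q \<noteq> k"
  by (simp add: skip_def)

lemma skip_less: "q < m \<Longrightarrow> skip k q < Suc m"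
  by (simp add: skip_def)

lemma minor_det_cong:
  assumes "\<And>p q. p < m \<Longrightarrow> q < m \<Longrightarrow> w q (\<rho> p) = w' q (\<rho>' p)"
  shows "minor_det m w \<rho> = minor_det m w' \<rho>'"
  unfolding minor_det_def by (rule arg_cong[of _ _ det]) (auto intro!: eq_matI simp: assms)

lemma minor_det_expand_column:
  assumes "k < Suc m"
  shows "minor_det (Suc m) w \<rho> =
    (\<Sum>p<Suc m. w k (\<rho> p) *
       ((-1) ^ (p + k) * minor_det m (\<lambda>q. w (skip k q)) (\<lambda>i. \<rho> (skip p i))))"
proof -
  let ?A = "mat (Suc m) (Suc m) (\<lambda>(p, q). w q (\<rho> p))"
  have "mat_delete ?A p k = mat m m (\<lambda>(i, q). w (skip k q) (\<rho> (skip p i)))" if "p < Suc m" for p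
    using that assms by (auto simp: mat_delete_def skip_def intro!: eq_matI)
  then show ?thesis
    unfolding minor_det_def using assms
    by (subst laplace_expansion_column[of _ "Suc m" k]) (auto simp: cofactor_def intro!: sum.cong)
qed

lemma minor_det_last_row:
  assumes "\<And>q. q < m \<Longrightarrow> w q (\<rho> m) = 0"
  shows "minor_det (Suc m) w \<rho> = w m (\<rho> m) * minor_det m w \<rho>"
proof -
  let ?A = "mat (Suc m) (Suc m) (\<lambda>(p, q). w q (\<rho> p))"
  have "mat_delete ?A m m = mat m m (\<lambda>(i, q). w q (\<rho> i))"
    by (auto simp: mat_delete_def intro!: eq_matI)
  then show ?thesis
    unfolding minor_det_def using assms
    by (subst laplace_expansion_row[of _ "Suc m" m]) (auto simp: cofactor_def lessThan_Suc)
qed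

lemma minor_det_zero_row:
  assumes "p < m" "\<And>q. q < m \<Longrightarrow> w q (\<rho> p) = 0"
  shows "minor_det m w \<rho> = 0"
  unfolding minor_det_def using assms by (subst laplace_expansion_row[of _ m p]) auto

lemma minor_det_equal_columns:
  assumes "j < m" "k < m" "j \<noteq> k" "w j = w k"
  shows "minor_det m w \<rho> = 0"
  unfolding minor_det_def using assms
  by (intro det_identical_columns[of _ m j k]) (auto intro!: eq_vecI)

lemma minor_det_equal_rows:
  assumes "j < m" "k < m" "j \<noteq> k" "\<rho> j = \<rho> k"
  shows "minor_det m w \<rho> = 0"
  unfolding minor_det_def using assms
  by (intro det_identical_rows[of _ m j k]) (auto intro!: eq_vecI)

text \<open>Expansion along column \<open>k\<close>: the cofactors see only the columns
  \<open>skip k q\<close>, which the update leaves alone.\<close>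

lemma minor_det_linear:
  assumes "k < m"
  shows "minor_det m (w(k := \<lambda>i. x i + r * y i)) \<rho> =
    minor_det m (w(k := x)) \<rho> + r * minor_det m (w(k := y)) \<rho>"
proof -
  from assms obtain m' where m: "m = Suc m'" by (cases m) auto
  have [simp]: "(\<lambda>q. (w(k := v)) (skip k q)) = (\<lambda>q. w (skip k q))" for v
    by (auto simp: skip_neq)
  show ?thesis
    unfolding m using assms
    by (simp only: minor_det_expand_column[of k] m, simp add: skip_neq sum_distrib_left sum.distrib[symmetric] algebra_simps del: sum.lessThan_Suc)
qed

lemma minor_det_zero_column:
  assumes "k < m"
  shows "minor_det m (w(k := \<lambda>i. 0)) \<rho> = 0"
  using minor_det_linear[OF assms, of w "\<lambda>i. 0" 1 "\<lambda>i. 0" \<rho>] by simp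

text \<open>The \<open>R\<close>-span of \<open>G\<close>, built by one summand at a time so that
  its induction rule matches \<open>minor_det_linear\<close>.\<close>

inductive_set combos :: "'r::comm_ring_1 set \<Rightarrow> ('i \<Rightarrow> 'r) set \<Rightarrow> ('i \<Rightarrow> 'r) set"
  for R and G where
  combos_zero: "(\<lambda>i. 0) \<in> combos R G"
| combos_add: "\<lbrakk>x \<in> combos R G; r \<in> R; y \<in> G\<rbrakk> \<Longrightarrow> (\<lambda>i. x i + r * y i) \<in> combos R G"

lemma combos_sum:
  assumes "finite T" "\<And>b. b \<in> T \<Longrightarrow> d b \<in> R" "\<And>b. b \<in> T \<Longrightarrow> v b \<in> G"
  shows "(\<lambda>i. \<Sum>b\<in>T. d b * v b i) \<in> combos R G"
  using assms
proof (induction T rule: finite_induct)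
  case (insert b T)
  then have "(\<lambda>i. (\<Sum>b\<in>T. d b * v b i) + d b * v b i) \<in> combos R G"
    by (intro combos_add) auto
  with insert show ?case by (simp add: add.commute)
qed (simp add: combos_zero)

text \<open>Repeated rows or columns give determinant 0, so for an ideal \<open>J\<close> this says
  that \<open>J\<close> contains the ideal of minors of the matrix with row set \<open>S\<close> and
  column set \<open>N\<close>.\<close>

definition minors_in ::
  "'r::comm_ring_1 set \<Rightarrow> nat \<Rightarrow> 'i set \<Rightarrow> ('i \<Rightarrow> 'r) set \<Rightarrow> bool" where
  "minors_in J m S N \<longleftrightarrow>
     (\<forall>w \<rho>. (\<forall>q<m. w q \<in> N) \<longrightarrow> (\<forall>p<m. \<rho> p \<in> S) \<longrightarrow> minor_det m w \<rho> \<in> J)"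

lemma minors_inD:
  assumes "minors_in J m S N" "\<And>q. q < m \<Longrightarrow> w q \<in> N" "\<And>p. p < m \<Longrightarrow> \<rho> p \<in> S"
  shows "minor_det m w \<rho> \<in> J"
  using assms unfolding minors_in_def by simp

text \<open>A minor reads its columns only at indices in \<open>S\<close>, so agreement on
  \<open>S\<close> is all that matters; what a column does elsewhere is an artefact of total
  functions.\<close>

lemma minors_in_mono_on:
  assumes "minors_in J m S N" "\<And>c. c \<in> N' \<Longrightarrow> \<exists>c'\<in>N. \<forall>i\<in>S. c i = c' i"
  shows "minors_in J m S N'"
  unfolding minors_in_def
proof (intro allI impI)
  fix w and \<rho> :: "nat \<Rightarrow> 'b"
  assume w: "\<forall>q<m. w q \<in> N'" and \<rho>: "\<forall>p<m. \<rho> p \<in> S"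
  from w assms(2) have "\<forall>q. \<exists>c'. q < m \<longrightarrow> c' \<in> N \<and> (\<forall>i\<in>S. w q i = c' i)" by blast
  then obtain w' where "\<forall>q. q < m \<longrightarrow> w' q \<in> N \<and> (\<forall>i\<in>S. w q i = w' q i)" by metis
  moreover from this have "minor_det m w \<rho> = minor_det m w' \<rho>"
    using \<rho> by (intro minor_det_cong) auto
  ultimately show "minor_det m w \<rho> \<in> J"
    using assms(1) \<rho> unfolding minors_in_def by auto
qed

context unital_subring
begin

text \<open>Multilinearity, one column at a time: in the inner induction \<open>k\<close> counts the
  leading columns that may already be combinations, while the later ones are still in
  \<open>G\<close>.\<close>

lemma minors_in_combos:
  assumes J: "ideal J (ring_on R)" and G: "minors_in J m S G"
  shows "minors_in J m S (combos R G)"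
proof -
  have "minor_det m w \<rho> \<in> J"
    if "\<forall>q<k. w q \<in> combos R G" "\<forall>q<m. k \<le> q \<longrightarrow> w q \<in> G" "\<forall>p<m. \<rho> p \<in> S" "k \<le> m"
    for k w \<rho>
    using that
  proof (induction k arbitrary: w)
    case 0
    then show ?case using G by (auto simp: minors_in_def)
  next
    case (Suc k)
    have "minor_det m (w(k := x)) \<rho> \<in> J" if "x \<in> combos R G" for x
      using that
    proof induction
      case combos_zero
      have "minor_det m (w(k := \<lambda>i. 0)) \<rho> = 0"
        using Suc.prems by (intro minor_det_zero_column) auto
      then show ?case using ideal_zero[OF J] by (simp del: fun_upd_apply)
    next
      case (combos_add x r y)
      have "minor_det m (w(k := y)) \<rho> \<in> J"
        using Suc.prems combos_add by (intro Suc.IH) auto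
      with combos_add show ?case
        using Suc.prems
        by (auto simp: minor_det_linear simp del: fun_upd_apply intro: ideal_add[OF J] ideal_mult[OF J])
    qed
    from this[of "w k"] show ?case using Suc.prems by simp
  qed
  from this[of m] show ?thesis unfolding minors_in_def by auto
qed

section \<open>Independence of the Fitting ideals of the presentation\<close>

text \<open>All relations serve as columns, which makes the predicate depend on the generators
  alone. Values outside \<open>S\<close> are arbitrary elements of \<open>R\<close>.\<close>

definition rel :: "'i set \<Rightarrow> ('i \<Rightarrow> 'r) \<Rightarrow> ('i \<Rightarrow> 'r) set" where
  "rel S e = {c. (\<forall>i. c i \<in> R) \<and> (\<Sum>i\<in>S. c i * e i) = 0}"

text \<open>The elementary step of Fitting's lemma: a redundant generator \<open>e z\<close> adds
  one row and essentially one relation \<open>D\<close>, so the size of the minors grows by one.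
  Modulo \<open>D\<close> every relation can be made to vanish at \<open>z\<close>, and these
  relations are the old ones.\<close>

lemma minors_in_insert_generator:
  fixes e :: "'i \<Rightarrow> 'r"
  assumes J: "ideal J (ring_on R)" and S: "finite S" "z \<notin> S"
    and C: "\<And>i. C i \<in> R" "e z = (\<Sum>i\<in>S. C i * e i)"
  shows "minors_in J m S (rel S e) \<longleftrightarrow> minors_in J (Suc m) (insert z S) (rel (insert z S) e)"
proof
  have upd: "(\<Sum>i\<in>S. (c(z := r)) i * e i) = (\<Sum>i\<in>S. c i * e i)" for c r
    using S by (intro sum.cong) auto
  define D where "D = C(z := - 1)"
  have D: "D \<in> rel (insert z S) e"
    using S C uminus_mem[OF one_mem] upd[of C "-1"] by (auto simp: D_def rel_def)
  show "minors_in J m S (rel S e)" if *: "minors_in J (Suc m) (insert z S) (rel (insert z S) e)"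
    unfolding minors_in_def
  proof (intro allI impI)
    fix w :: "nat \<Rightarrow> 'i \<Rightarrow> 'r" and \<rho> :: "nat \<Rightarrow> 'i"
    assume w: "\<forall>q<m. w q \<in> rel S e" and \<rho>: "\<forall>p<m. \<rho> p \<in> S"
    \<comment> \<open>The minor is bordered by the column \<open>D\<close> and the row
      \<open>z\<close>. That row is 0 except for the entry -1 in the corner, so the bordered
      determinant is the old one up to sign.\<close>
    define w' where "w' q = (if q < m then (w q)(z := 0) else D)" for q
    define \<rho>' where "\<rho>' p = (if p < m then \<rho> p else z)" for p
    have "w' q \<in> rel (insert z S) e" if "q < Suc m" for q
      using w S D upd[of "w q" 0] that by (auto simp: w'_def rel_def zero_mem)
    then have "minor_det (Suc m) w' \<rho>' \<in> J"
      using * \<rho> unfolding minors_in_def by (auto simp: \<rho>'_def)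
    also have "minor_det (Suc m) w' \<rho>' = - minor_det m w' \<rho>'"
      by (subst minor_det_last_row) (auto simp: w'_def \<rho>'_def D_def)
    also have "minor_det m w' \<rho>' = minor_det m w \<rho>"
      using \<rho> S by (intro minor_det_cong) (auto simp: w'_def \<rho>'_def)
    finally show "minor_det m w \<rho> \<in> J" using ideal_uminus[OF J] by fastforce
  qed
  show "minors_in J (Suc m) (insert z S) (rel (insert z S) e)" if *: "minors_in J m S (rel S e)"
  proof -
    define U where "U = {u \<in> rel (insert z S) e. u z = 0}"
    have U: "minors_in J m (insert z S) U"
      unfolding minors_in_def
    proof (intro allI impI)
      fix w :: "nat \<Rightarrow> 'i \<Rightarrow> 'r" and \<rho> :: "nat \<Rightarrow> 'i"
      assume w: "\<forall>q<m. w q \<in> U" and \<rho>: "\<forall>p<m. \<rho> p \<in> insert z S"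
      show "minor_det m w \<rho> \<in> J"
      proof (cases "\<exists>p<m. \<rho> p = z")
        case True
        then have "minor_det m w \<rho> = 0"
          using w by (auto simp: U_def intro: minor_det_zero_row)
        then show ?thesis using ideal_zero[OF J] by simp
      next
        case False
        then have "\<forall>p<m. \<rho> p \<in> S" using \<rho> by auto
        moreover have "\<forall>q<m. w q \<in> rel S e" using w S by (auto simp: U_def rel_def)
        ultimately show ?thesis using * by (auto simp: minors_in_def)
      qed
    qed
    have "minors_in J (Suc m) (insert z S) (insert D U)"
      unfolding minors_in_def
    proof (intro allI impI)
      fix w :: "nat \<Rightarrow> 'i \<Rightarrow> 'r" and \<rho> :: "nat \<Rightarrow> 'i"
      assume w: "\<forall>q<Suc m. w q \<in> insert D U" and \<rho>: "\<forall>p<Suc m. \<rho> p \<in> insert z S"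
      \<comment> \<open>\<open>k\<close> is a column equal to \<open>D\<close> if there is one;
        otherwise any column will do, and 0 exists because there are \<open>Suc m\<close> of them. A
        second copy of \<open>D\<close> makes the minor vanish. In the remaining case all columns
        other than \<open>k\<close> lie in \<open>U\<close>, and expansion along \<open>k\<close>
        reduces to minors of size \<open>m\<close>.\<close>
      define k where "k = (if \<exists>q<Suc m. w q = D then SOME q. q < Suc m \<and> w q = D else 0)"
      have k: "k < Suc m" and kD: "(\<exists>q<Suc m. w q = D) \<Longrightarrow> w k = D"
        using someI_ex[of "\<lambda>q. q < Suc m \<and> w q = D"] by (auto simp: k_def)
      show "minor_det (Suc m) w \<rho> \<in> J"
      proof (cases "\<exists>q<Suc m. q \<noteq> k \<and> w q = D")
        case True
        then have "minor_det (Suc m) w \<rho> = 0"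
          using k kD by (metis minor_det_equal_columns)
        then show ?thesis using ideal_zero[OF J] by simp
      next
        case False
        with w have "\<forall>q<m. w (skip k q) \<in> U"
          by (metis insert_iff skip_less skip_neq)
        then have "minor_det m (\<lambda>q. w (skip k q)) (\<lambda>i. \<rho> (skip p i)) \<in> J" for p
          using U \<rho> skip_less[of _ m p] unfolding minors_in_def by auto
        moreover have "w k (\<rho> p) \<in> R" for p
          using w k D by (auto simp: U_def rel_def)
        ultimately show ?thesis
          unfolding minor_det_expand_column[OF k]
          by (intro ideal_sum[OF J] ideal_mult[OF J]) (auto intro: ring_closed)
      qed
    qed
    from minors_in_combos[OF J this] show ?thesis
    proof (rule minors_in_mono_on)
      fix c assume c: "c \<in> rel (insert z S) e"
      \<comment> \<open>Since \<open>D z\<close> is -1, adding \<open>c z\<close> times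
        \<open>D\<close> cancels the coordinate of \<open>c\<close> at \<open>z\<close>.\<close>
      define u where "u = (\<lambda>i. c i + c z * D i)"
      have "(\<Sum>i\<in>insert z S. u i * e i) =
        (\<Sum>i\<in>insert z S. c i * e i) + c z * (\<Sum>i\<in>insert z S. D i * e i)"
        by (simp add: u_def algebra_simps sum.distrib sum_distrib_left)
      then have "u \<in> U"
        using c D C(1) unfolding U_def rel_def by (auto simp: u_def D_def intro!: ring_closed)
      then have "(\<lambda>i. (\<lambda>i. (\<lambda>i. 0) i + 1 * u i) i + (- c z) * D i) \<in> combos R (insert D U)"
        using c by (intro combos_add combos_zero) (auto simp: rel_def intro!: ring_closed)
      then show "\<exists>c'\<in>combos R (insert D U). \<forall>i\<in>insert z S. c i = c' i"
        by (rule rev_bexI) (auto simp: u_def)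
    qed
  qed
qed

lemma minors_in_Un_generators:
  assumes J: "ideal J (ring_on R)" and S: "finite S" and T: "finite T" "S \<inter> T = {}"
    and C: "\<And>z. z \<in> T \<Longrightarrow> \<exists>C. (\<forall>i. C i \<in> R) \<and> e z = (\<Sum>i\<in>S. C i * e i)"
  shows "minors_in J m S (rel S e) \<longleftrightarrow> minors_in J (m + card T) (S \<union> T) (rel (S \<union> T) e)"
  using T C
proof (induction T rule: finite_induct)
  case (insert z T)
  from insert.prems obtain C where C: "\<forall>i. C i \<in> R" "e z = (\<Sum>i\<in>S. C i * e i)" by blast
  \<comment> \<open>Extending the coefficients by 0 turns redundancy over \<open>S\<close> into
    redundancy over the larger set reached so far.\<close>
  define C' where "C' i = (if i \<in> S then C i else 0)" for i
  have "(\<Sum>i\<in>S \<union> T. C' i * e i) = (\<Sum>i\<in>S. C' i * e i)"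
    using S insert by (intro sum.mono_neutral_right) (auto simp: C'_def)
  also have "\<dots> = e z" using C by (simp add: C'_def)
  finally have "minors_in J (m + card T) (S \<union> T) (rel (S \<union> T) e) \<longleftrightarrow>
      minors_in J (Suc (m + card T)) (insert z (S \<union> T)) (rel (insert z (S \<union> T)) e)"
    using insert S C by (intro minors_in_insert_generator[OF J, of _ _ C']) (auto simp: C'_def zero_mem)
  with insert show ?case by (auto simp: Un_insert_right)
qed simp

lemma minors_in_reindex:
  fixes e :: "'j \<Rightarrow> 'r" and h :: "'i \<Rightarrow> 'j"
  assumes h: "inj h"
  shows "minors_in J m (h ` S) (rel (h ` S) e) \<longleftrightarrow> minors_in J m S (rel S (e \<circ> h))"
proof -
  have sum_h: "(\<Sum>i\<in>h ` S. c i * e i) = (\<Sum>i\<in>S. c (h i) * e (h i))" for c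
    using h by (subst sum.reindex) (auto simp: inj_on_def)
  show ?thesis
  proof
    assume l: "minors_in J m (h ` S) (rel (h ` S) e)"
    show "minors_in J m S (rel S (e \<circ> h))"
      unfolding minors_in_def
    proof (intro allI impI)
      fix w :: "nat \<Rightarrow> 'i \<Rightarrow> 'r" and \<rho> :: "nat \<Rightarrow> 'i"
      assume w: "\<forall>q<m. w q \<in> rel S (e \<circ> h)" and \<rho>: "\<forall>p<m. \<rho> p \<in> S"
      have "\<forall>q<m. (\<lambda>j. w q (inv_into UNIV h j)) \<in> rel (h ` S) e"
        using w h by (auto simp: rel_def sum_h)
      then have "minor_det m (\<lambda>q j. w q (inv_into UNIV h j)) (\<lambda>p. h (\<rho> p)) \<in> J"
        using l \<rho> unfolding minors_in_def by simp
      then show "minor_det m w \<rho> \<in> J"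
        using h by (simp add: minor_det_def)
    qed
  next
    assume r: "minors_in J m S (rel S (e \<circ> h))"
    show "minors_in J m (h ` S) (rel (h ` S) e)"
      unfolding minors_in_def
    proof (intro allI impI)
      fix w :: "nat \<Rightarrow> 'j \<Rightarrow> 'r" and \<rho> :: "nat \<Rightarrow> 'j"
      assume w: "\<forall>q<m. w q \<in> rel (h ` S) e" and \<rho>: "\<forall>p<m. \<rho> p \<in> h ` S"
      have "\<forall>q<m. (\<lambda>i. w q (h i)) \<in> rel S (e \<circ> h)"
        using w by (auto simp: rel_def sum_h)
      moreover have "inv_into UNIV h (\<rho> p) \<in> S" "h (inv_into UNIV h (\<rho> p)) = \<rho> p" if "p < m" for p
        using \<rho> that h by auto
      ultimately have "minor_det m (\<lambda>q i. w q (h i)) (\<lambda>p. inv_into UNIV h (\<rho> p)) \<in> J"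
        using r unfolding minors_in_def by simp
      also have "minor_det m (\<lambda>q i. w q (h i)) (\<lambda>p. inv_into UNIV h (\<rho> p)) = minor_det m w \<rho>"
        by (rule minor_det_cong) (use \<open>\<And>p. p < m \<Longrightarrow> h (inv_into UNIV h (\<rho> p)) = \<rho> p\<close> in auto)
      finally show "minor_det m w \<rho> \<in> J" .
    qed
  qed
qed

definition spans :: "nat \<Rightarrow> (nat \<Rightarrow> 'r) \<Rightarrow> 'r set \<Rightarrow> bool" where
  "spans g e M \<longleftrightarrow> e ` {..<g} \<subseteq> M \<and>
     (\<forall>z\<in>M. \<exists>C. (\<forall>i. C i \<in> R) \<and> z = (\<Sum>i<g. C i * e i))"

lemma spans_lift:
  assumes "inj h" "h ` {..<g} = S" "\<And>i. i < g \<Longrightarrow> e' (h i) = e i" "spans g e M" "z \<in> M"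
  shows "\<exists>C. (\<forall>i. C i \<in> R) \<and> z = (\<Sum>i\<in>S. C i * e' i)"
proof -
  from assms obtain C where C: "\<forall>i. C i \<in> R" "z = (\<Sum>i<g. C i * e i)"
    by (auto simp: spans_def)
  have "(\<Sum>i\<in>S. C (inv_into UNIV h i) * e' i) = (\<Sum>i<g. C i * e i)"
    unfolding assms(2)[symmetric] using assms(1,3)
    by (subst sum.reindex) (auto simp: inj_on_def)
  with C show ?thesis by (intro exI[of _ "\<lambda>i. C (inv_into UNIV h i)"]) auto
qed

text \<open>Both tuples are compared with their concatenation, indexed by the disjoint sum.\<close>

lemma minors_in_generators_independent:
  assumes J: "ideal J (ring_on R)" and e: "spans g e M" and e': "spans g' e' M"
    and i: "i \<le> g" "i \<le> g'"
  shows "minors_in J (g - i) {..<g} (rel {..<g} e) \<longleftrightarrow>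
    minors_in J (g' - i) {..<g'} (rel {..<g'} e')"
proof -
  define S :: "(nat + nat) set" where "S = Inl ` {..<g}"
  define S' :: "(nat + nat) set" where "S' = Inr ` {..<g'}"
  define E where "E = case_sum e e'"
  have card: "card S = g" "card S' = g'"
    by (simp_all add: S_def S'_def card_image)
  have comp: "E \<circ> Inl = e" "E \<circ> Inr = e'"
    by (auto simp: E_def)
  have fin: "finite S" "finite S'" "S \<inter> S' = {}" by (auto simp: S_def S'_def)
  have E: "E z \<in> M" if "z \<in> S \<union> S'" for z
    using that e e' by (auto simp: S_def S'_def E_def spans_def)
  have "minors_in J (g - i) S (rel S E) \<longleftrightarrow>
      minors_in J (g - i + card S') (S \<union> S') (rel (S \<union> S') E)"
    using fin E by (intro minors_in_Un_generators[OF J] spans_lift[OF _ _ _ e, of Inl]) (auto simp: S_def E_def)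
  moreover have "minors_in J (g' - i) S' (rel S' E) \<longleftrightarrow>
      minors_in J (g' - i + card S) (S' \<union> S) (rel (S' \<union> S) E)"
    using fin E by (intro minors_in_Un_generators[OF J] spans_lift[OF _ _ _ e', of Inr]) (auto simp: S'_def E_def)
  \<comment> \<open>The bounds on \<open>i\<close> matter here: with truncated subtraction the two
    sizes could differ.\<close>
  moreover have "g - i + card S' = g' - i + card S" using i card by simp
  ultimately have "minors_in J (g - i) S (rel S E) \<longleftrightarrow> minors_in J (g' - i) S' (rel S' E)"
    by (simp add: Un_commute)
  then show ?thesis
    unfolding S_def S'_def by (simp add: minors_in_reindex comp)
qed

section \<open>Free presentations of an ideal and its Fitting ideals\<close>

lemma submodule_on_simps [simp]:
  "carrier (submodule_on M) = M" "x \<oplus>\<^bsub>submodule_on M\<^esub> y = x + y" "\<zero>\<^bsub>submodule_on M\<^esub> = 0"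
  "c \<odot>\<^bsub>submodule_on M\<^esub> x = c * x"
  by (simp_all add: submodule_on_def)

lemma finsum_submodule_on:
  assumes M: "0 \<in> M" "\<And>a b. a \<in> M \<Longrightarrow> b \<in> M \<Longrightarrow> a + b \<in> M"
    and "finite S" "\<And>i. i \<in> S \<Longrightarrow> f i \<in> M"
  shows "(\<Oplus>\<^bsub>submodule_on M\<^esub>i\<in>S. f i) = (\<Sum>i\<in>S. f i)"
proof -
  interpret abelian_monoid "submodule_on M"
    by (rule abelian_monoidI) (use M in \<open>auto simp: add_ac\<close>)
  show ?thesis
    using assms(3,4) by (induction S rule: finite_induct) (auto simp: Pi_def)
qed

text \<open>Module sums become ordinary sums once the generators lie in \<open>M\<close>. If some
  generator does not, both sides are false, which is why the proof splits on this condition.\<close>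

lemma free_presentation_iff:
  assumes M: "ideal M (ring_on R)"
  shows "free_presentation R (submodule_on M) g e B \<phi> \<longleftrightarrow>
     spans g e M \<and> \<phi> \<in> B \<rightarrow> free_module R g \<and>
     (\<forall>c\<in>free_module R g. (\<Sum>i<g. c $ i * e i) = 0 \<longleftrightarrow>
        (\<exists>T d. finite T \<and> T \<subseteq> B \<and> d \<in> T \<rightarrow> R \<and> c = vec g (\<lambda>i. \<Sum>b\<in>T. d b * \<phi> b $ i)))"
proof (cases "e \<in> {..<g} \<rightarrow> M")
  case True
  have c: "c $ i \<in> R" if "c \<in> free_module R g" "i < g" for c :: "'r vec" and i
    using that unfolding free_module_def by (auto simp: vec_set_def)
  have fs: "(\<Oplus>\<^bsub>submodule_on M\<^esub>i\<in>{..<g}. c $ i * e i) = (\<Sum>i<g. c $ i * e i)"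
    if "c \<in> free_module R g" for c :: "'r vec"
    using True c[OF that]
    by (intro finsum_submodule_on) (auto intro: ideal_zero[OF M] ideal_add[OF M] ideal_mult[OF M])
  have "(\<exists>C. (\<forall>i. C i \<in> R) \<and> z = (\<Sum>i<g. C i * e i)) \<longleftrightarrow>
    (\<exists>c\<in>free_module R g. z = (\<Sum>i<g. c $ i * e i))" for z
  proof
    assume "\<exists>C. (\<forall>i. C i \<in> R) \<and> z = (\<Sum>i<g. C i * e i)"
    then obtain C where "\<forall>i. C i \<in> R" "z = (\<Sum>i<g. C i * e i)" by blast
    then show "\<exists>c\<in>free_module R g. z = (\<Sum>i<g. c $ i * e i)"
      by (intro bexI[of _ "vec g C"]) (auto simp: free_module_def vec_set_def)
  next
    assume "\<exists>c\<in>free_module R g. z = (\<Sum>i<g. c $ i * e i)"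
    then obtain d :: "'r vec" where "d \<in> free_module R g" "z = (\<Sum>i<g. d $ i * e i)" by blast
    then show "\<exists>C. (\<forall>i. C i \<in> R) \<and> z = (\<Sum>i<g. C i * e i)"
      using c by (intro exI[of _ "\<lambda>i. if i < g then d $ i else 0"]) (auto simp: zero_mem)
  qed
  also have "(\<exists>c\<in>free_module R g. z = (\<Sum>i<g. c $ i * e i)) \<longleftrightarrow>
    (\<exists>c\<in>free_module R g. z = (\<Oplus>\<^bsub>submodule_on M\<^esub>i\<in>{..<g}. c $ i * e i))" for z
    by (rule bex_cong[OF refl]) (simp only: fs)
  finally have span: "(\<forall>z\<in>M. \<exists>C. (\<forall>i. C i \<in> R) \<and> z = (\<Sum>i<g. C i * e i)) \<longleftrightarrow>
    (\<forall>z\<in>M. \<exists>c\<in>free_module R g. z = (\<Oplus>\<^bsub>submodule_on M\<^esub>i\<in>{..<g}. c $ i * e i))"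
    by (rule ball_cong[OF refl])
  have rels: "(\<forall>c\<in>free_module R g. (\<Sum>i<g. c $ i * e i) = 0 \<longleftrightarrow> P c) \<longleftrightarrow>
    (\<forall>c\<in>free_module R g. (\<Oplus>\<^bsub>submodule_on M\<^esub>i\<in>{..<g}. c $ i * e i) = 0 \<longleftrightarrow> P c)" for P
    by (rule ball_cong[OF refl]) (simp only: fs)
  show ?thesis
    unfolding free_presentation_def spans_def submodule_on_simps span rels
      image_subset_iff_funcset by blast
next
  case False
  then show ?thesis
    unfolding free_presentation_def spans_def by auto
qed

text \<open>Exactness makes the columns \<open>\<phi> b\<close> relations and every relation a
  combination of them, so by \<open>minors_in_combos\<close> it makes no difference which of the two
  sets of columns is tested. Choices with repetition are absent from \<open>minors\<close>, but
  their determinants are 0.\<close>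

lemma minors_subset_iff:
  assumes M: "ideal M (ring_on R)" and J: "ideal J (ring_on R)"
    and pres: "free_presentation R (submodule_on M) g e B \<phi>"
  shows "minors m g B \<phi> \<subseteq> J \<longleftrightarrow> minors_in J m {..<g} (rel {..<g} e)"
proof
  note pres = pres[unfolded free_presentation_iff[OF M]]
  define col where "col v = (\<lambda>i. if i < g then v $ i else 0)" for v :: "'r vec"
  have free: "col v i \<in> R" if "v \<in> free_module R g" for v i
    using that by (auto simp: free_module_def vec_set_def col_def zero_mem)
  show "minors m g B \<phi> \<subseteq> J" if *: "minors_in J m {..<g} (rel {..<g} e)"
  proof
    fix x assume "x \<in> minors m g B \<phi>"
    then obtain \<rho> cols where x: "x = det (mat m m (\<lambda>(p, q). \<phi> (cols q) $ \<rho> p))"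
      and \<rho>: "\<rho> ` {..<m} \<subseteq> {..<g}" and cols: "cols ` {..<m} \<subseteq> B"
      unfolding minors_def by blast
    have "col (\<phi> b) \<in> rel {..<g} e" if b: "b \<in> B" for b
    proof -
      have \<phi>: "\<phi> b \<in> free_module R g" using pres b by auto
      have "\<exists>T d. finite T \<and> T \<subseteq> B \<and> d \<in> T \<rightarrow> R \<and> \<phi> b = vec g (\<lambda>i. \<Sum>b\<in>T. d b * \<phi> b $ i)"
        using b \<phi> by (intro exI[of _ "{b}"] exI[of _ "\<lambda>_. 1"]) (auto simp: one_mem free_module_def)
      then have "(\<Sum>i<g. \<phi> b $ i * e i) = 0" using pres \<phi> by blast
      with free[OF \<phi>] show ?thesis by (simp add: rel_def col_def)
    qed
    then have "\<forall>q<m. col (\<phi> (cols q)) \<in> rel {..<g} e" "\<forall>p<m. \<rho> p \<in> {..<g}"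
      using \<rho> cols by auto
    then have "minor_det m (\<lambda>q. col (\<phi> (cols q))) \<rho> \<in> J"
      by (intro minors_inD[OF *]) auto
    also have "minor_det m (\<lambda>q. col (\<phi> (cols q))) \<rho> = x"
      unfolding x minor_det_def using \<rho>
      by (intro arg_cong[of _ _ det] eq_matI) (auto simp: col_def)
    finally show "x \<in> J" .
  qed
  show "minors_in J m {..<g} (rel {..<g} e)" if *: "minors m g B \<phi> \<subseteq> J"
  proof -
    have "minors_in J m {..<g} ((\<lambda>b. col (\<phi> b)) ` B)"
      unfolding minors_in_def
    proof (intro allI impI)
      fix w and \<rho> :: "nat \<Rightarrow> nat"
      assume w: "\<forall>q<m. w q \<in> (\<lambda>b. col (\<phi> b)) ` B" and \<rho>: "\<forall>p<m. \<rho> p \<in> {..<g}"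
      from w have "\<forall>q. \<exists>b. q < m \<longrightarrow> b \<in> B \<and> w q = col (\<phi> b)" by blast
      from choice[OF this] obtain cols
        where cols: "\<forall>q<m. cols q \<in> B \<and> w q = col (\<phi> (cols q))" by blast
      consider "inj_on \<rho> {..<m}" "inj_on cols {..<m}" | "\<not> inj_on \<rho> {..<m}"
        | "\<not> inj_on cols {..<m}" by blast
      then show "minor_det m w \<rho> \<in> J"
      proof cases
        case 1
        have "minor_det m w \<rho> = det (mat m m (\<lambda>(p, q). \<phi> (cols q) $ \<rho> p))"
          unfolding minor_det_def using \<rho> cols
          by (intro arg_cong[of _ _ det] eq_matI) (auto simp: col_def)
        also have "\<dots> \<in> minors m g B \<phi>"
          unfolding minors_def using 1 \<rho> cols by blast
        finally show ?thesis using * by blast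
      next
        case 2
        then obtain j k where "j < m" "k < m" "j \<noteq> k" "\<rho> j = \<rho> k"
          unfolding inj_on_def by auto
        then have "minor_det m w \<rho> = 0"
          by (rule minor_det_equal_rows)
        then show ?thesis using ideal_zero[OF J] by simp
      next
        case 3
        then obtain j k where "j < m" "k < m" "j \<noteq> k" "cols j = cols k"
          unfolding inj_on_def by auto
        then have "minor_det m w \<rho> = 0"
          using cols by (metis minor_det_equal_columns)
        then show ?thesis using ideal_zero[OF J] by simp
      qed
    qed
    from minors_in_combos[OF J this] show ?thesis
    proof (rule minors_in_mono_on)
      fix c assume c: "c \<in> rel {..<g} e"
      then have "vec g c \<in> free_module R g" "(\<Sum>i<g. vec g c $ i * e i) = 0"
        by (auto simp: rel_def free_module_def vec_set_def)
      then obtain T d where T: "finite T" "T \<subseteq> B" "d \<in> T \<rightarrow> R"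
        "vec g c = vec g (\<lambda>i. \<Sum>b\<in>T. d b * \<phi> b $ i)" using pres by blast
      have "(\<lambda>i. \<Sum>b\<in>T. d b * col (\<phi> b) i) \<in> combos R ((\<lambda>b. col (\<phi> b)) ` B)"
        using T by (intro combos_sum) auto
      moreover have "c i = (\<Sum>b\<in>T. d b * col (\<phi> b) i)" if "i < g" for i
        using arg_cong[OF T(4), of "\<lambda>v::'r vec. v $ i"] that by (simp add: col_def)
      ultimately show "\<exists>c'\<in>combos R ((\<lambda>b. col (\<phi> b)) ` B). \<forall>i\<in>{..<g}. c i = c' i"
        by auto
    qed
  qed
qed

text \<open>One convenient generating tuple suffices: independence carries the test with
  \<open>J\<close> to every presentation, which gives uniqueness for the definite description. The
  bound on \<open>i\<close> is required for all generating tuples so that no difference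
  \<open>g' - i\<close> is truncated.\<close>

lemma fitting_ideal_eqI:
  assumes M: "ideal M (ring_on R)" and F: "ideal F (ring_on R)"
    and e: "spans g e M" and i: "\<And>g' e'. spans g' e' M \<Longrightarrow> i \<le> g'"
    and least: "\<And>J. ideal J (ring_on R) \<Longrightarrow>
      minors_in J (g - i) {..<g} (rel {..<g} e) \<longleftrightarrow> F \<subseteq> J"
  shows "fitting_ideal R i (submodule_on M) = F"
proof -
  have eq: "genideal (ring_on R) (minors (g' - i) g' B \<phi>) = F"
    if pres: "free_presentation R (submodule_on M) g' e' B \<phi>" for g' e' and B :: "'r vec set" and \<phi>
  proof (rule genideal_ring_on_eqI[OF F])
    fix J assume J: "ideal J (ring_on R)"
    have e': "spans g' e' M" using pres by (simp add: free_presentation_iff[OF M])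
    show "minors (g' - i) g' B \<phi> \<subseteq> J \<longleftrightarrow> F \<subseteq> J"
      using minors_subset_iff[OF M J pres] least[OF J]
        minors_in_generators_independent[OF J e e' i[OF e] i[OF e']] by simp
  qed
  \<comment> \<open>Existence is witnessed by the tautological presentation, whose columns are all
    the relation vectors.\<close>
  have "free_presentation R (submodule_on M) g e
      {c \<in> free_module R g. (\<Sum>i<g. c $ i * e i) = 0} (\<lambda>c. c)"
    unfolding free_presentation_iff[OF M]
  proof (intro conjI ballI iffI)
    fix c :: "'r vec" assume c: "c \<in> free_module R g" "(\<Sum>i<g. c $ i * e i) = 0"
    then show "\<exists>T d. finite T \<and> T \<subseteq> {c \<in> free_module R g. (\<Sum>i<g. c $ i * e i) = 0} \<and>
      d \<in> T \<rightarrow> R \<and> c = vec g (\<lambda>i. \<Sum>b\<in>T. d b * b $ i)"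
      by (intro exI[of _ "{c}"] exI[of _ "\<lambda>_. 1"]) (auto simp: one_mem free_module_def)
  next
    fix c :: "'r vec" assume "\<exists>T d. finite T \<and> T \<subseteq> {c \<in> free_module R g. (\<Sum>i<g. c $ i * e i) = 0} \<and>
      d \<in> T \<rightarrow> R \<and> c = vec g (\<lambda>i. \<Sum>b\<in>T. d b * b $ i)"
    then obtain T and d :: "'r vec \<Rightarrow> 'r" where T: "\<forall>b\<in>T. (\<Sum>i<g. (b :: 'r vec) $ i * e i) = 0"
      "c = vec g (\<lambda>i. \<Sum>b\<in>T. d b * b $ i)" by blast
    have "(\<Sum>i<g. c $ i * e i) = (\<Sum>i<g. \<Sum>b\<in>T. d b * (b $ i * e i))"
      by (simp add: T(2) sum_distrib_right mult.assoc)
    also have "\<dots> = (\<Sum>b\<in>T. d b * (\<Sum>i<g. b $ i * e i))"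
      by (subst sum.swap) (simp add: sum_distrib_left)
    also have "\<dots> = 0" using T(1) by simp
    finally show "(\<Sum>i<g. c $ i * e i) = 0" .
  qed (use e in auto)
  then show ?thesis
    unfolding fitting_ideal_def by (intro the_equality) (use eq in blast)+
qed

end

section \<open>The subalgebras of \<open>K[x]\<close> containing \<open>K[x\<^sup>2]\<close>\<close>

text \<open>A nonzero element of least degree divides the others by division with remainder; if
  there is none, \<open>d\<close> is 0. Bare closure conditions are used because the ideals to which
  this applies are sets of denominators, coefficients or combinations given by
  comprehension.\<close>

lemma poly_ideal_principal:
  fixes N :: "'a::field poly set"
  assumes "0 \<in> N" "\<And>p q. p \<in> N \<Longrightarrow> q \<in> N \<Longrightarrow> p + q \<in> N" "\<And>p q. q \<in> N \<Longrightarrow> p * q \<in> N"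
  obtains d where "d \<in> N" "\<And>p. p \<in> N \<Longrightarrow> d dvd p"
proof (cases "N \<subseteq> {0}")
  case True
  with assms(1) that[of 0] show ?thesis by auto
next
  case False
  then obtain q where "q \<in> N \<and> q \<noteq> 0" by auto
  from ex_has_least_nat[where P = "\<lambda>q. q \<in> N \<and> q \<noteq> 0" and m = degree, OF this]
  obtain d where d: "d \<in> N" "d \<noteq> 0" and least: "\<And>q. q \<in> N \<Longrightarrow> q \<noteq> 0 \<Longrightarrow> degree d \<le> degree q"
    by blast
  have "d dvd p" if "p \<in> N" for p
  proof (rule ccontr)
    assume "\<not> d dvd p"
    then have nz: "p mod d \<noteq> 0" by (simp add: dvd_eq_mod_eq_0)
    have "p mod d = p + (- (p div d)) * d"
      by (simp add: minus_div_mult_eq_mod[symmetric])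
    then have "p mod d \<in> N" using assms(2,3) that d by metis
    with nz least[of "p mod d"] degree_mod_less[OF d(2), of p] show False by auto
  qed
  with d that show ?thesis by blast
qed

lemma dvd_X_power:
  fixes q :: "'a::field poly"
  assumes "q dvd [:0, 1:] ^ j"
  obtains c i where "c \<noteq> 0" "q = smult c ([:0, 1:] ^ i)"
proof -
  have "\<exists>c i. c \<noteq> 0 \<and> q = smult c ([:0, 1:] ^ i)"
    using assms
  proof (induction j arbitrary: q)
    case 0
    then obtain c where "q = [:c:]" "c dvd 1" by (auto simp: is_unit_poly_iff)
    then show ?case by (intro exI[of _ c] exI[of _ 0]) auto
  next
    case (Suc j)
    from Suc.prems obtain h where h: "[:0, 1:] ^ Suc j = q * h" by (rule dvdE)
    \<comment> \<open>Evaluation at 0 shows that the indeterminate divides one of the two factors;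
      cancelling it lowers the exponent.\<close>
    from arg_cong[OF h, of "\<lambda>p. poly p 0"] have "poly q 0 = 0 \<or> poly h 0 = 0" by simp
    then show ?case
    proof
      assume "poly q 0 = 0"
      then obtain q' where q': "q = [:0, 1:] * q'" using poly_eq_0_iff_dvd[of q 0] by (auto elim: dvdE)
      with Suc.prems have "[:0, 1:] * q' dvd [:0, 1:] * [:0, 1:] ^ j" by (simp only: power_Suc)
      then have "q' dvd [:0, 1:] ^ j" by (subst (asm) dvd_mult_cancel_left) auto
      then obtain c i where "c \<noteq> 0" "q' = smult c ([:0, 1:] ^ i)" using Suc.IH by blast
      with q' show ?thesis by (intro exI[of _ c] exI[of _ "Suc i"]) auto
    next
      assume "poly h 0 = 0"
      then obtain h' where "h = [:0, 1:] * h'" using poly_eq_0_iff_dvd[of h 0] by (auto elim: dvdE)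
      with h have "[:0, 1:] * [:0, 1:] ^ j = [:0, 1:] * (q * h')" by (simp add: mult_ac)
      then have "[:0, 1:] ^ j = q * h'" by (simp only: mult_cancel_left) auto
      then show ?thesis using Suc.IH[of q] by (metis dvd_triv_left)
    qed
  qed
  with that show ?thesis by blast
qed

text \<open>The element p(x^2) of K(x). Parametrising A by \<open>'a poly\<close> makes degree,
  division and divisibility of polynomials available for A.\<close>

definition sq_poly :: "'a::field poly \<Rightarrow> 'a poly fract" where
  "sq_poly p = to_fract (pcompose p [:0, 0, 1:])"

lemma sq_poly_0 [simp]: "sq_poly 0 = 0"
  and sq_poly_1 [simp]: "sq_poly 1 = 1"
  and sq_poly_add [simp]: "sq_poly (p + q) = sq_poly p + sq_poly q"
  and sq_poly_diff [simp]: "sq_poly (p - q) = sq_poly p - sq_poly q"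
  and sq_poly_uminus [simp]: "sq_poly (- p) = - sq_poly p"
  and sq_poly_mult [simp]: "sq_poly (p * q) = sq_poly p * sq_poly q"
  and sq_poly_const [simp]: "sq_poly [:c:] = to_fract [:c:]"
  by (simp_all add: sq_poly_def pcompose_add pcompose_diff pcompose_uminus pcompose_mult pcompose_1)

lemma sq_poly_power [simp]: "sq_poly (p ^ k) = sq_poly p ^ k"
  by (induction k) auto

lemma sq_poly_X: "sq_poly [:0, 1:] = indet ^ 2"
  by (simp add: sq_poly_def indet_def pcompose_pCons power2_eq_square flip: to_fract_mult)

lemma sq_poly_pCons: "sq_poly (pCons c p) = to_fract [:c:] + indet ^ 2 * sq_poly p"
proof -
  have "pCons c p = [:c:] + [:0, 1:] * p" by simp
  then show ?thesis by (simp only: sq_poly_add sq_poly_mult sq_poly_const sq_poly_X)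
qed

lemma indet_nonzero [simp]: "indet \<noteq> 0"
  by (simp add: indet_def)

lemma indet_power_even: "even k \<Longrightarrow> indet ^ k = sq_poly ([:0, 1:] ^ (k div 2))"
  by (auto simp: sq_poly_X power_mult[symmetric])

lemma indet_power_odd: "odd k \<Longrightarrow> indet ^ k = sq_poly ([:0, 1:] ^ (k div 2)) * indet"
  by (auto simp: sq_poly_X power_mult[symmetric] elim!: oddE)

text \<open>Multiplication by x exchanges the even and the odd part, up to a factor x^2 on the old
  odd one.\<close>

lemma to_fract_decompose: "\<exists>a b. to_fract p = sq_poly a + sq_poly b * indet"
proof (induction p)
  case 0
  show ?case by (rule exI[of _ 0], rule exI[of _ 0]) simp
next
  case (pCons c p)
  then obtain a b where ab: "to_fract p = sq_poly a + sq_poly b * indet" by blast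
  have "pCons c p = [:c:] + [:0, 1:] * p" by simp
  then have "to_fract (pCons c p) = to_fract [:c:] + indet * to_fract p"
    by (simp only: to_fract_add to_fract_mult indet_def)
  also have "\<dots> = sq_poly (pCons c b) + sq_poly a * indet"
    by (simp add: ab sq_poly_pCons algebra_simps power2_eq_square)
  finally show ?case by blast
qed

text \<open>Parity of degrees: a nonzero p(x^2) has even degree, and x times such a polynomial has
  odd degree.\<close>

lemma sq_poly_decomposition_zero:
  assumes "sq_poly a + sq_poly b * indet = 0"
  shows "a = 0 \<and> b = 0"
proof -
  let ?s = "\<lambda>p. pcompose p [:0, 0, 1::'a:]"
  have deg: "degree (?s p) = 2 * degree p" for p by (simp add: degree_pcompose)
  have zero: "?s p = 0 \<longleftrightarrow> p = 0" for p by (rule pcompose_eq_0_iff) simp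
  have "to_fract (?s a + ?s b * [:0, 1:]) = 0"
    using assms by (simp only: sq_poly_def indet_def to_fract_add to_fract_mult)
  then have eq: "?s a = - (?s b * [:0, 1:])"
    by (simp only: to_fract_eq_0_iff add_eq_0_iff2)
  have "b = 0"
  proof (rule ccontr)
    assume b: "b \<noteq> 0"
    have "degree (?s b * [:0, 1:]) = 2 * degree b + 1"
      using b zero[of b] by (subst degree_mult_eq) (auto simp: deg)
    with arg_cong[OF eq, of degree] have "2 * degree a = 2 * degree b + 1" by (simp only: degree_minus deg)
    then show False by presburger
  qed
  with eq zero[of a] show ?thesis by simp
qed

lemma sq_poly_decomposition_odd_zero:
  assumes "odd m" "sq_poly a + sq_poly b * indet ^ m = 0"
  shows "a = 0 \<and> b = 0"
  using sq_poly_decomposition_zero[of a "b * [:0, 1:] ^ (m div 2)"] assms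
  by (auto simp: indet_power_odd[OF assms(1)] mult.assoc)

lemma sq_poly_decomposition_unique:
  assumes "odd m" "sq_poly a + sq_poly b * indet ^ m = sq_poly a' + sq_poly b' * indet ^ m"
  shows "a = a'" "b = b'"
proof -
  have "sq_poly (a - a') + sq_poly (b - b') * indet ^ m = 0"
    using assms(2) by (simp add: algebra_simps)
  from sq_poly_decomposition_odd_zero[OF assms(1) this] show "a = a'" "b = b'" by auto
qed

lemma sq_poly_eq_iff [simp]: "sq_poly a = sq_poly b \<longleftrightarrow> a = b"
  using sq_poly_decomposition_unique(1)[of 1 a 0 b 0] by auto

lemma sq_poly_eq_0_iff [simp]: "sq_poly a = 0 \<longleftrightarrow> a = 0"
  using sq_poly_eq_iff[of a 0] by simp

text \<open>One family for all the rings involved: the exponent \<open>n\<close> gives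
  \<open>R\<close>, the exponent 1 gives K[x], and the exponent \<open>f\<close> will give the
  multiplier ring. It is closed under products because x^(2m) lies in A.\<close>

definition sq_order :: "nat \<Rightarrow> 'a::field poly fract set" where
  "sq_order m = {sq_poly a + sq_poly b * indet ^ m | a b. True}"

lemma sq_orderI: "sq_poly a + sq_poly b * indet ^ m \<in> sq_order m"
  by (auto simp: sq_order_def)

lemma sq_poly_in_sq_order: "sq_poly a \<in> sq_order m"
  using sq_orderI[of a 0] by simp

lemma indet_power_in_sq_order:
  assumes "odd m" "odd k" "m \<le> k"
  shows "(indet :: 'a::field poly fract) ^ k \<in> sq_order m"
proof -
  have "(indet :: 'a poly fract) ^ k = indet ^ (k - m) * indet ^ m"
    using assms by (simp flip: power_add)
  also have "(indet :: 'a poly fract) ^ (k - m) = sq_poly ([:0, 1:] ^ ((k - m) div 2))"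
    using assms by (intro indet_power_even) auto
  finally show ?thesis using sq_orderI[of 0 "[:0, 1:] ^ ((k - m) div 2)" m] by simp
qed

lemma unital_subring_sq_order: "unital_subring (sq_order m :: 'a::field poly fract set)"
proof
  show "1 \<in> sq_order m" using sq_poly_in_sq_order[of 1 m] by simp
  fix y z :: "'a poly fract" assume "y \<in> sq_order m" "z \<in> sq_order m"
  then obtain a b c d where y: "y = sq_poly a + sq_poly b * indet ^ m"
    and z: "z = sq_poly c + sq_poly d * indet ^ m"
    by (auto simp: sq_order_def)
  have "y - z = sq_poly (a - c) + sq_poly (b - d) * indet ^ m"
    by (simp add: y z algebra_simps)
  then show "y - z \<in> sq_order m" by (simp only: sq_orderI)
  have "(indet :: 'a poly fract) ^ m * indet ^ m = sq_poly ([:0, 1:] ^ m)"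
    by (simp add: sq_poly_X flip: power_mult power_add mult_2)
  then have "y * z = sq_poly (a * c + b * d * [:0, 1:] ^ m) + sq_poly (a * d + b * c) * indet ^ m"
    by (simp only: y z sq_poly_add sq_poly_mult) (simp add: algebra_simps)
  then show "y * z \<in> sq_order m" by (simp only: sq_orderI)
qed

lemma range_to_fract: "range to_fract = (sq_order 1 :: 'a::field poly fract set)"
proof
  show "range to_fract \<subseteq> (sq_order 1 :: 'a poly fract set)"
  proof
    fix y :: "'a poly fract" assume "y \<in> range to_fract"
    then obtain a b where "y = sq_poly a + sq_poly b * indet ^ 1"
      using to_fract_decompose by fastforce
    then show "y \<in> sq_order 1" using sq_orderI by metis
  qed
  show "(sq_order 1 :: 'a poly fract set) \<subseteq> range to_fract"
    by (auto simp: sq_order_def sq_poly_def indet_def simp flip: to_fract_mult to_fract_add)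
qed

section \<open>Identification with the subalgebras given by generators\<close>

lemma adjoin_subset:
  fixes B :: "'a::field poly fract set"
  assumes "unital_subring B" "\<And>c. to_fract [:c:] \<in> B" "S \<subseteq> B"
  shows "adjoin S \<subseteq> B"
proof
  interpret unital_subring B by (rule assms)
  interpret L: cring "ring_of_type_algebra :: 'a poly fract ring"
    by (rule cring_from_type_algebra)
  have inv: "\<ominus>\<^bsub>ring_of_type_algebra\<^esub> h = - h" for h :: "'a poly fract"
    by (rule L.minus_equality) (auto simp: ring_of_type_algebra_def)
  fix y :: "'a poly fract" assume "y \<in> adjoin S"
  then show "y \<in> B"
    unfolding adjoin_def
  proof induction
    case (a_inv h)
    then show ?case by (simp add: inv uminus_mem)
  qed (use assms in \<open>auto simp: ring_of_type_algebra_def intro: ring_closed\<close>)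
qed

lemma adjoin_const: "to_fract [:c:] \<in> adjoin S"
  and adjoin_incl: "y \<in> S \<Longrightarrow> y \<in> adjoin S"
  by (auto simp: adjoin_def intro: generate_ring.incl)

lemma adjoin_add: "y \<in> adjoin S \<Longrightarrow> z \<in> adjoin S \<Longrightarrow> y + z \<in> adjoin S"
  using generate_ring.eng_add[of y ring_of_type_algebra _ z]
  by (simp add: adjoin_def ring_of_type_algebra_def)

lemma adjoin_mult: "y \<in> adjoin S \<Longrightarrow> z \<in> adjoin S \<Longrightarrow> y * z \<in> adjoin S"
  using generate_ring.eng_mult[of y ring_of_type_algebra _ z]
  by (simp add: adjoin_def ring_of_type_algebra_def)

lemma sq_poly_in_adjoin:
  assumes "indet ^ 2 \<in> S"
  shows "sq_poly p \<in> adjoin S"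
proof (induction p)
  case 0
  then show ?case using adjoin_const[of 0] by simp
next
  case (pCons c p)
  then show ?case using adjoin_incl[OF assms]
    by (simp add: sq_poly_pCons adjoin_add adjoin_mult adjoin_const)
qed

lemma unital_subring_range_sq_poly: "unital_subring (range sq_poly)"
proof
  show "1 \<in> range sq_poly" using rangeI[of sq_poly 1] by simp
qed (auto simp flip: sq_poly_diff sq_poly_mult)

lemma const_in_sq_order: "to_fract [:c:] \<in> sq_order m"
  using sq_poly_in_sq_order[of "[:c:]"] by simp

lemma adjoin_indet_sq: "adjoin {indet ^ 2} = range (sq_poly :: 'a::field poly \<Rightarrow> _)"
proof
  show "adjoin {indet ^ 2} \<subseteq> range (sq_poly :: 'a poly \<Rightarrow> _)"
    using rangeI[of sq_poly "[:0, 1::'a:]"] rangeI[of sq_poly "[:c::'a:]" for c]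
    by (intro adjoin_subset unital_subring_range_sq_poly) (auto simp: sq_poly_X)
qed (auto intro: sq_poly_in_adjoin)

lemma adjoin_indet_sq_odd:
  assumes "odd m"
  shows "adjoin {indet ^ 2, indet ^ m} = (sq_order m :: 'a::field poly fract set)"
proof
  show "adjoin {indet ^ 2, indet ^ m} \<subseteq> (sq_order m :: 'a poly fract set)"
    using sq_poly_in_sq_order[of "[:0, 1::'a:]" m] indet_power_in_sq_order[OF assms assms, where 'a = 'a]
    by (intro adjoin_subset unital_subring_sq_order) (auto simp: sq_poly_X const_in_sq_order)
  show "(sq_order m :: 'a poly fract set) \<subseteq> adjoin {indet ^ 2, indet ^ m}"
    using adjoin_incl[of "indet ^ m" "{indet ^ 2, indet ^ m}"]
    by (auto simp: sq_order_def intro!: adjoin_add adjoin_mult sq_poly_in_adjoin)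
qed

lemma adjoin_indet: "adjoin {indet} = (sq_order 1 :: 'a::field poly fract set)"
proof -
  have sub: "adjoin {indet ^ 2, indet ^ 1} \<subseteq> B" if "unital_subring B" "\<And>c. to_fract [:c:] \<in> B" "indet \<in> B"
    for B :: "'a poly fract set"
    using that unital_subring.power_mem[OF that(1,3)] by (intro adjoin_subset) auto
  show ?thesis
  proof
    show "adjoin {indet} \<subseteq> (sq_order 1 :: 'a poly fract set)"
      using indet_power_in_sq_order[of 1 1, where 'a = 'a]
      by (intro adjoin_subset unital_subring_sq_order) (auto simp: const_in_sq_order)
    have "indet ^ 2 \<in> (adjoin {indet} :: 'a poly fract set)"
      by (auto simp: power2_eq_square intro: adjoin_mult adjoin_incl)
    then have "sq_poly a \<in> adjoin {indet}" for a :: "'a poly"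
    proof (induction a)
      case 0
      then show ?case using adjoin_const[of 0] by simp
    next
      case (pCons c p)
      then show ?case by (simp add: sq_poly_pCons adjoin_add adjoin_mult adjoin_const)
    qed
    then show "sq_order 1 \<subseteq> (adjoin {indet} :: 'a poly fract set)"
      using adjoin_incl[of "indet" "{indet}"]
      by (auto simp: sq_order_def intro!: adjoin_add adjoin_mult)
  qed
qed

text \<open>A coefficient from K[x] is split into even and odd part: since m - 1 is even, the even
  part times x^(m-1) is absorbed by A, and the odd part yields A x^m.\<close>

lemma sq_order_conv:
  assumes "odd m"
  shows "(sq_order m :: 'a::field poly fract set) = {a + b * indet ^ (m - 1) | a b. a \<in> adjoin {indet ^ 2} \<and> b \<in> adjoin {indet}}"
    (is "_ = ?r")
proof -
  have e: "(indet :: 'a poly fract) ^ (m - 1) = sq_poly ([:0, 1:] ^ (m div 2))"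
    using assms by (subst indet_power_even) (auto elim!: oddE)
  have o: "(indet :: 'a poly fract) ^ m = indet * indet ^ (m - 1)"
    using assms by (auto simp: odd_pos simp flip: power_Suc)
  show ?thesis
  proof
    show "sq_order m \<subseteq> ?r"
    proof
      fix y :: "'a poly fract" assume "y \<in> sq_order m"
      then obtain a b where "y = sq_poly a + (sq_poly 0 + sq_poly b * indet ^ 1) * indet ^ (m - 1)"
        by (auto simp: sq_order_def o mult.assoc)
      then show "y \<in> ?r"
        unfolding adjoin_indet_sq adjoin_indet using sq_orderI by blast
    qed
    show "?r \<subseteq> sq_order m"
    proof
      fix y :: "'a poly fract" assume "y \<in> ?r"
      then obtain a b c where "y = sq_poly a + (sq_poly b + sq_poly c * indet ^ 1) * indet ^ (m - 1)"
        unfolding adjoin_indet_sq adjoin_indet sq_order_def by blast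
      also have "\<dots> = sq_poly (a + b * [:0, 1:] ^ (m div 2)) + sq_poly c * indet ^ m"
        by (simp add: o e[simplified] algebra_simps)
      finally show "y \<in> sq_order m" by (simp only: sq_orderI)
    qed
  qed
qed

section \<open>Multiplier rings and conductors\<close>

text \<open>The denominators of \<open>y\<close> form an ideal \<open>(d)\<close> of \<open>K[x]\<close>; the equation shows that \<open>d y\<close> is again
  a denominator, so \<open>d\<close> divides \<open>d y\<close>.\<close>

lemma poly_integrally_closed:
  fixes y :: "'a::field poly fract"
  assumes y: "y * y = to_fract b * y + to_fract c"
  shows "y \<in> range to_fract"
proof -
  define N where "N = {d. \<exists>m. to_fract d * y = to_fract m}"
  obtain d where d: "d \<in> N" "\<And>p. p \<in> N \<Longrightarrow> d dvd p"
  proof (rule poly_ideal_principal[of N])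
    show "0 \<in> N" by (auto simp: N_def intro: exI[of _ 0])
    show "p + q \<in> N" if pq: "p \<in> N" "q \<in> N" for p q
    proof -
      from pq obtain k l where "to_fract p * y = to_fract k" "to_fract q * y = to_fract l"
        by (auto simp: N_def)
      then have "to_fract (p + q) * y = to_fract (k + l)" by (simp add: distrib_right)
      then show ?thesis unfolding N_def by blast
    qed
    show "p * q \<in> N" if q: "q \<in> N" for p q
    proof -
      from q obtain l where "to_fract q * y = to_fract l" by (auto simp: N_def)
      then have "to_fract (p * q) * y = to_fract (p * l)" by (simp add: mult.assoc)
      then show ?thesis unfolding N_def by blast
    qed
  qed blast
  from d(1) obtain m where m: "to_fract d * y = to_fract m" by (auto simp: N_def)
  obtain a a' where "y = to_fract a / to_fract a'" "a' \<noteq> 0"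
    by (cases y) (auto simp: Fract_conv_to_fract)
  then have "a' \<in> N" by (auto simp: N_def)
  with \<open>a' \<noteq> 0\<close> d(2) have "d \<noteq> 0" by auto
  have "to_fract m * y = to_fract d * (y * y)"
    by (simp add: m[symmetric] mult.assoc)
  also have "\<dots> = to_fract b * (to_fract d * y) + to_fract c * to_fract d"
    by (simp add: y algebra_simps)
  also have "\<dots> = to_fract (b * m + c * d)" by (simp add: m)
  finally have "m \<in> N" unfolding N_def by blast
  then obtain k where "m = d * k" using d(2) by (auto elim: dvdE)
  with m \<open>d \<noteq> 0\<close> have "y = to_fract k" by simp
  then show ?thesis by simp
qed

text \<open>If k < m, then x^m is x^k times a positive even power; comparing coefficients of x^k
  would make a positive power of the indeterminate divide 1. The equivalence allows \<open>m\<close>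
  to be recovered from the ring.\<close>

lemma indet_power_in_sq_order_iff:
  assumes "odd m" "odd k"
  shows "(indet :: 'a::field poly fract) ^ k \<in> sq_order m \<longleftrightarrow> m \<le> k"
proof
  assume "(indet :: 'a poly fract) ^ k \<in> sq_order m"
  then obtain a b where ab: "(indet :: 'a poly fract) ^ k = sq_poly a + sq_poly b * indet ^ m"
    by (auto simp: sq_order_def)
  show "m \<le> k"
  proof (rule ccontr)
    assume "\<not> m \<le> k"
    then have m: "m = m - k + k" and pos: "(m - k) div 2 > 0" and ev: "even (m - k)"
      using assms by (auto elim!: oddE)
    have "(indet :: 'a poly fract) ^ m = indet ^ (m - k) * indet ^ k"
      by (subst m) (simp only: power_add)
    then have "sq_poly 0 + sq_poly 1 * indet ^ k =
        sq_poly a + sq_poly (b * [:0, 1:] ^ ((m - k) div 2)) * indet ^ k"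
      using ab by (simp add: indet_power_even[OF ev] mult.assoc)
    then have "1 = b * [:0, 1:] ^ ((m - k) div 2)"
      by (rule sq_poly_decomposition_unique(2)[OF assms(2)])
    from arg_cong[OF this, of "\<lambda>p. poly p 0"] pos show False by (simp add: power_0_left)
  qed
qed (use assms in \<open>auto intro: indet_power_in_sq_order\<close>)

text \<open>The larger ring is generated over A by 1 and x^f, hence the two conditions. For c = a +
  b x^n, the product c x^f is b x^(n+f) + a x^f; the first term lies in A because n + f is even, so
  the only condition is that x^(n-f) divides a.\<close>

lemma
  fixes c :: "'a::field poly fract"
  assumes "odd n" "odd f" "f \<le> n"
  shows conductor_sq_order_iff: "c \<in> conductor (sq_order n) (sq_order f) \<longleftrightarrow>
      c \<in> sq_order n \<and> c * indet ^ f \<in> sq_order n" (is "?A c")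
    and conductor_sq_order_decompose: "conductor (sq_order n) (sq_order f) =
      {sq_poly a * indet ^ (n - f) + sq_poly b * indet ^ n | a b :: 'a poly. True}" (is ?B)
proof -
  interpret unital_subring "sq_order n :: 'a poly fract set" by (rule unital_subring_sq_order)
  show iff: "?A c" for c :: "'a poly fract"
  proof
    assume "c \<in> conductor (sq_order n) (sq_order f)"
    then show "c \<in> sq_order n \<and> c * indet ^ f \<in> sq_order n"
      using indet_power_in_sq_order[of f f, where 'a = 'a] assms by (auto simp: conductor_def)
  next
    assume c: "c \<in> sq_order n \<and> c * indet ^ f \<in> sq_order n"
    have "c * s \<in> sq_order n" if s: "s \<in> sq_order f" for s
    proof -
      from s obtain a b where "s = sq_poly a + sq_poly b * indet ^ f" by (auto simp: sq_order_def)
      then have "c * s = sq_poly a * c + sq_poly b * (c * indet ^ f)" by (simp add: algebra_simps)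
      then show ?thesis using c by (simp add: add_mem mult_mem sq_poly_in_sq_order)
    qed
    with c show "c \<in> conductor (sq_order n) (sq_order f)" by (simp add: conductor_def)
  qed
  define i where "i = (n - f) div 2"
  have nf: "(indet :: 'a poly fract) ^ (n - f) = sq_poly ([:0, 1:] ^ i)"
    using assms unfolding i_def by (intro indet_power_even) auto
  have n: "(indet :: 'a poly fract) ^ n = indet ^ (n - f) * indet ^ f"
    using assms by (simp flip: power_add)
  have nn: "(indet :: 'a poly fract) ^ n * indet ^ f = sq_poly ([:0, 1:] ^ ((n + f) div 2))"
    using assms by (simp only: flip: power_add) (intro indet_power_even, auto)
  show ?B
  proof (intro equalityI subsetI)
    fix c :: "'a poly fract" assume "c \<in> conductor (sq_order n) (sq_order f)"
    then have c: "c \<in> sq_order n" "c * indet ^ f \<in> sq_order n" by (auto simp: iff)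
    from c(1) obtain a b where ab: "c = sq_poly a + sq_poly b * indet ^ n" by (auto simp: sq_order_def)
    from c(2) obtain a' b' where "c * indet ^ f = sq_poly a' + sq_poly b' * indet ^ n"
      by (auto simp: sq_order_def)
    then have "sq_poly (b * [:0, 1:] ^ ((n + f) div 2)) + sq_poly a * indet ^ f =
        sq_poly a' + sq_poly (b' * [:0, 1:] ^ i) * indet ^ f"
      using nn by (simp only: ab n[symmetric] sq_poly_mult) (simp add: n nf algebra_simps)
    then have "a = b' * [:0, 1:] ^ i" by (rule sq_poly_decomposition_unique(2)[OF assms(2)])
    then have "c = sq_poly b' * indet ^ (n - f) + sq_poly b * indet ^ n" by (simp add: ab nf)
    then show "c \<in> {sq_poly a * indet ^ (n - f) + sq_poly b * indet ^ n | a b. True}" by blast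
  next
    fix c :: "'a poly fract"
    assume "c \<in> {sq_poly a * indet ^ (n - f) + sq_poly b * indet ^ n | a b. True}"
    then obtain a b where c: "c = sq_poly a * indet ^ (n - f) + sq_poly b * indet ^ n" by blast
    have "c = sq_poly (a * [:0, 1:] ^ i) + sq_poly b * indet ^ n" by (simp add: c nf)
    moreover have "c * indet ^ f = sq_poly (b * [:0, 1:] ^ ((n + f) div 2)) + sq_poly a * indet ^ n"
      using nn by (simp add: c distrib_right mult.assoc flip: n)
    ultimately show "c \<in> conductor (sq_order n) (sq_order f)"
      unfolding iff by (metis sq_orderI)
  qed
qed

lemma conductor_sq_order_conv:
  assumes "odd n" "odd f" "f \<le> n"
  shows "conductor (sq_order n) (sq_order f) =
    {a * indet ^ (n - f) + b * indet ^ (n - 1) | a b :: 'a::field poly fract.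
       a \<in> adjoin {indet ^ 2} \<and> b \<in> adjoin {indet}}"
proof -
  have e: "(indet :: 'a poly fract) ^ (n - 1) = sq_poly ([:0, 1:] ^ (f div 2)) * indet ^ (n - f)"
  proof -
    have nf: "f - 1 + (n - f) = n - 1" and f2: "(f - 1) div 2 = f div 2" and "even (f - 1)"
      using assms by (auto elim!: oddE)
    then have "(indet :: 'a poly fract) ^ (f - 1) = sq_poly ([:0, 1:] ^ (f div 2))"
      using indet_power_even[of "f - 1"] by simp
    moreover have "(indet :: 'a poly fract) ^ (n - 1) = indet ^ (f - 1) * indet ^ (n - f)"
      by (simp only: power_add[symmetric] nf)
    ultimately show ?thesis by simp
  qed
  have o: "(indet :: 'a poly fract) ^ n = indet * indet ^ (n - 1)"
    using assms by (auto simp: odd_pos simp flip: power_Suc)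
  show ?thesis
    unfolding conductor_sq_order_decompose[OF assms] adjoin_indet_sq adjoin_indet
  proof (intro equalityI subsetI)
    fix c :: "'a poly fract"
    assume "c \<in> {sq_poly a * indet ^ (n - f) + sq_poly b * indet ^ n | a b. True}"
    then obtain a b where "c = sq_poly a * indet ^ (n - f) + (sq_poly 0 + sq_poly b * indet ^ 1) * indet ^ (n - 1)"
      by (auto simp: o mult.assoc)
    then show "c \<in> {a * indet ^ (n - f) + b * indet ^ (n - 1) | a b.
        a \<in> range sq_poly \<and> b \<in> sq_order 1}" using sq_orderI by blast
  next
    fix c :: "'a poly fract"
    assume "c \<in> {a * indet ^ (n - f) + b * indet ^ (n - 1) | a b. a \<in> range sq_poly \<and> b \<in> sq_order 1}"
    then obtain a b d where
      "c = sq_poly a * indet ^ (n - f) + (sq_poly b + sq_poly d * indet ^ 1) * indet ^ (n - 1)"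
      unfolding sq_order_def by blast
    also have "\<dots> = sq_poly (a + b * [:0, 1:] ^ (f div 2)) * indet ^ (n - f) + sq_poly d * indet ^ n"
      by (simp add: o e[simplified] algebra_simps)
    finally show "c \<in> {sq_poly a * indet ^ (n - f) + sq_poly b * indet ^ n | a b. True}" by blast
  qed
qed

section \<open>The ideal as a lattice of rank two over K[x^2]\<close>

locale sq_order_ideal =
  fixes n :: nat and I :: "'a::field poly fract set"
  assumes odd_n: "odd n" and ideal_I: "ideal I (ring_on (sq_order n))" and nonzero: "I \<noteq> {0}"
begin

interpretation R: unital_subring "sq_order n :: 'a poly fract set"
  by (rule unital_subring_sq_order)

lemmas I_zero = R.ideal_zero[OF ideal_I]
  and I_add = R.ideal_add[OF ideal_I]
  and I_diff = R.ideal_diff[OF ideal_I]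
  and I_mult = R.ideal_mult[OF ideal_I]

lemma I_sq_poly_mult: "z \<in> I \<Longrightarrow> sq_poly a * z \<in> I"
  by (rule I_mult[OF sq_poly_in_sq_order])

text \<open>A triangular basis: \<open>p0\<close> generates the intersection of \<open>I\<close>
  with A, and \<open>q1\<close> generates the ideal of coefficients at x^n, lifted to an element of
  \<open>I\<close> by some \<open>p1\<close>. Independence needs \<open>p0\<close> and
  \<open>q1\<close> to be nonzero.\<close>

lemma ex_basis:
  obtains e0 e1 where "e0 \<in> I" "e1 \<in> I" "\<And>z. z \<in> I \<Longrightarrow> \<exists>a b. z = sq_poly a * e0 + sq_poly b * e1"
    "\<And>a b. sq_poly a * e0 + sq_poly b * e1 = 0 \<Longrightarrow> a = 0 \<and> b = 0"
proof -
  define N0 where "N0 = {a. sq_poly a \<in> I}"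
  define N1 where "N1 = {b. \<exists>a. sq_poly a + sq_poly b * indet ^ n \<in> I}"
  obtain p0 where p0: "p0 \<in> N0" "\<And>p. p \<in> N0 \<Longrightarrow> p0 dvd p"
  proof (rule poly_ideal_principal[of N0])
    show "p * q \<in> N0" if "q \<in> N0" for p q using that by (simp add: N0_def I_sq_poly_mult)
  qed (auto simp: N0_def I_zero I_add)
  obtain q1 where q1: "q1 \<in> N1" "\<And>p. p \<in> N1 \<Longrightarrow> q1 dvd p"
  proof (rule poly_ideal_principal[of N1])
    show "0 \<in> N1" unfolding N1_def using I_zero by (auto intro: exI[of _ 0])
    show "p + q \<in> N1" if pq: "p \<in> N1" "q \<in> N1" for p q
    proof -
      from pq obtain a b where "sq_poly a + sq_poly p * indet ^ n \<in> I" "sq_poly b + sq_poly q * indet ^ n \<in> I"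
        by (auto simp: N1_def)
      from I_add[OF this] have "sq_poly (a + b) + sq_poly (p + q) * indet ^ n \<in> I"
        by (simp add: algebra_simps)
      then show ?thesis unfolding N1_def by blast
    qed
    show "p * q \<in> N1" if q: "q \<in> N1" for p q
    proof -
      from q obtain a where "sq_poly a + sq_poly q * indet ^ n \<in> I" by (auto simp: N1_def)
      from I_sq_poly_mult[OF this, of p] have "sq_poly (p * a) + sq_poly (p * q) * indet ^ n \<in> I"
        by (simp add: algebra_simps)
      then show ?thesis unfolding N1_def by blast
    qed
  qed blast
  from q1(1) obtain p1 where p1: "sq_poly p1 + sq_poly q1 * indet ^ n \<in> I" by (auto simp: N1_def)
  have "indet ^ n \<in> sq_order n" using odd_n by (simp add: indet_power_in_sq_order)
  obtain z where z: "z \<in> I" "z \<noteq> 0" using nonzero I_zero by blast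
  then have "z \<in> sq_order n" using R.ideal_subset[OF ideal_I] by blast
  then obtain a b where ab: "z = sq_poly a + sq_poly b * indet ^ n" by (auto simp: sq_order_def)
  \<comment> \<open>The conjugate of \<open>z\<close> under the substitution of -x for x, as
    \<open>n\<close> is odd. The product is the norm, a nonzero element of \<open>I\<close> that
    lies in A.\<close>
  define z' where "z' = sq_poly a + sq_poly (- b) * indet ^ n"
  have "z' \<noteq> 0"
    using sq_poly_decomposition_odd_zero[OF odd_n, of a "- b"] z(2) by (auto simp: z'_def ab)
  have nn: "(indet :: 'a poly fract) ^ n * indet ^ n = sq_poly ([:0, 1:] ^ n)"
    by (simp add: sq_poly_X flip: power_mult power_add mult_2)
  define w where "w = a * a - b * b * [:0, 1:] ^ n"
  have w: "z' * z = sq_poly w"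
    unfolding w_def
    by (simp only: sq_poly_diff sq_poly_mult nn[symmetric]) (simp add: z'_def ab algebra_simps)
  have "z' * z \<in> I" unfolding z'_def by (rule I_mult[OF sq_orderI z(1)])
  then have "w \<in> N0" by (simp add: N0_def w)
  moreover have "w \<noteq> 0" using w \<open>z' \<noteq> 0\<close> z(2) by auto
  ultimately have "p0 \<noteq> 0" using p0(2) by auto
  \<comment> \<open>Multiplying by x^n moves \<open>p0\<close> into the ideal of coefficients at
    x^n, so \<open>q1\<close> divides \<open>p0\<close> and cannot be 0.\<close>
  have "sq_poly 0 + sq_poly p0 * indet ^ n \<in> I"
    using I_mult[OF \<open>indet ^ n \<in> sq_order n\<close>, of "sq_poly p0"] p0(1) by (simp add: N0_def mult.commute)
  then have "p0 \<in> N1" unfolding N1_def by blast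
  with q1(2) \<open>p0 \<noteq> 0\<close> have "q1 \<noteq> 0" by auto
  show ?thesis
  proof (rule that[of "sq_poly p0" "sq_poly p1 + sq_poly q1 * indet ^ n"])
    show "sq_poly p0 \<in> I" using p0(1) by (simp add: N0_def)
    show "sq_poly p1 + sq_poly q1 * indet ^ n \<in> I" by (rule p1)
    fix z assume z: "z \<in> I"
    then have "z \<in> sq_order n" using R.ideal_subset[OF ideal_I] by blast
    then obtain a b where ab: "z = sq_poly a + sq_poly b * indet ^ n" by (auto simp: sq_order_def)
    with z have "b \<in> N1" unfolding N1_def by blast
    then obtain d where d: "b = q1 * d" using q1(2) by (auto elim: dvdE)
    have "sq_poly (a - d * p1) = z - sq_poly d * (sq_poly p1 + sq_poly q1 * indet ^ n)"
      by (simp add: ab d algebra_simps)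
    also have "\<dots> \<in> I" by (intro I_diff z I_sq_poly_mult p1)
    finally have "p0 dvd a - d * p1" using p0(2) by (simp add: N0_def)
    then obtain c where "a - d * p1 = p0 * c" by (auto elim: dvdE)
    then have c: "a = p0 * c + d * p1" by (simp add: algebra_simps)
    have "z = sq_poly c * sq_poly p0 + sq_poly d * (sq_poly p1 + sq_poly q1 * indet ^ n)"
      by (simp add: ab c d algebra_simps)
    then show "\<exists>a b. z = sq_poly a * sq_poly p0 + sq_poly b * (sq_poly p1 + sq_poly q1 * indet ^ n)"
      by blast
  next
    fix a b assume "sq_poly a * sq_poly p0 + sq_poly b * (sq_poly p1 + sq_poly q1 * indet ^ n) = 0"
    then have "sq_poly (a * p0 + b * p1) + sq_poly (b * q1) * indet ^ n = 0"
      by (simp add: algebra_simps)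
    from sq_poly_decomposition_odd_zero[OF odd_n this] show "a = 0 \<and> b = 0"
      using \<open>p0 \<noteq> 0\<close> \<open>q1 \<noteq> 0\<close> by auto
  qed
qed

end

section \<open>The multiplier ring in terms of a basis\<close>

locale sq_order_ideal_basis = sq_order_ideal n I for n and I :: "'a::field poly fract set" +
  fixes e0 e1 :: "'a poly fract"
  assumes e0: "e0 \<in> I" and e1: "e1 \<in> I"
    and span: "\<And>z. z \<in> I \<Longrightarrow> \<exists>a b. z = sq_poly a * e0 + sq_poly b * e1"
    and independent: "\<And>a b. sq_poly a * e0 + sq_poly b * e1 = 0 \<Longrightarrow> a = 0 \<and> b = 0"
begin

interpretation R: unital_subring "sq_order n :: 'a poly fract set"
  by (rule unital_subring_sq_order)

lemma e0_nonzero: "e0 \<noteq> 0" and e1_nonzero: "e1 \<noteq> 0"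
  using independent[of 1 0] independent[of 0 1] by auto

lemma coordinates_unique:
  assumes "sq_poly a * e0 + sq_poly b * e1 = sq_poly c * e0 + sq_poly d * e1"
  shows "a = c \<and> b = d"
  using independent[of "a - c" "b - d"] assms by (auto simp: algebra_simps)

text \<open>Multipliers are taken in all of K(x); \<open>multiplier_ring_eq\<close> later places
  them in the fraction field of \<open>R\<close>.\<close>

definition multipliers :: "'a poly fract set" where
  "multipliers = {y. \<forall>z\<in>I. y * z \<in> I}"

lemma unital_subring_multipliers: "unital_subring multipliers"
  by unfold_locales (auto simp: multipliers_def left_diff_distrib mult.assoc intro: I_diff)

interpretation M: unital_subring multipliers
  by (rule unital_subring_multipliers)

lemma sq_order_subset_multipliers: "sq_order n \<subseteq> multipliers"
  by (auto simp: multipliers_def intro: I_mult)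

lemma sq_poly_in_multipliers: "sq_poly a \<in> multipliers"
  using sq_order_subset_multipliers sq_poly_in_sq_order by blast

lemma multipliersI:
  assumes "y * e0 \<in> I" "y * e1 \<in> I"
  shows "y \<in> multipliers"
  unfolding multipliers_def
proof (intro CollectI ballI)
  fix z assume "z \<in> I"
  then obtain a b where "z = sq_poly a * e0 + sq_poly b * e1" using span by blast
  then have "y * z = sq_poly a * (y * e0) + sq_poly b * (y * e1)" by (simp add: algebra_simps)
  then show "y * z \<in> I" using assms by (simp add: I_add I_sq_poly_mult)
qed

lemma multipliers_matrix:
  assumes "y \<in> multipliers"
  obtains p q r s where "y * e0 = sq_poly p * e0 + sq_poly q * e1" "y * e1 = sq_poly r * e0 + sq_poly s * e1"
  using assms span[of "y * e0"] span[of "y * e1"] e0 e1 by (auto simp: multipliers_def)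

text \<open>A multiplier is a zero of the characteristic polynomial of its matrix.\<close>

lemma multipliers_integral: "multipliers \<subseteq> sq_order 1"
proof
  fix y assume "y \<in> multipliers"
  then obtain p q r s where y: "y * e0 = sq_poly p * e0 + sq_poly q * e1"
    "y * e1 = sq_poly r * e0 + sq_poly s * e1"
    by (rule multipliers_matrix)
  have "(y - sq_poly p) * (y - sq_poly s) * e0 = (y - sq_poly s) * (y * e0 - sq_poly p * e0)"
    by (simp add: algebra_simps)
  also have "y * e0 - sq_poly p * e0 = sq_poly q * e1" by (simp add: y(1))
  also have "(y - sq_poly s) * (sq_poly q * e1) = sq_poly q * (y * e1 - sq_poly s * e1)"
    by (simp add: algebra_simps)
  also have "\<dots> = sq_poly q * sq_poly r * e0" by (simp add: y(2))
  finally have "(y - sq_poly p) * (y - sq_poly s) = sq_poly q * sq_poly r" using e0_nonzero by simp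
  then have "y * y = sq_poly (p + s) * y + sq_poly (q * r - p * s)" by (simp add: algebra_simps)
  then show "y \<in> sq_order 1"
    unfolding range_to_fract[symmetric] sq_poly_def by (rule poly_integrally_closed)
qed

text \<open>Integrality writes a multiplier as a + b x with a, b in A. Since A consists of
  multipliers, only the ideal \<open>N\<close> of the coefficients b counts. If it is generated by
  the power \<open>j\<close> of the indeterminate, the exponent sought is 2 j + 1.\<close>

lemma multipliers_eq: "\<exists>m. odd m \<and> m \<le> n \<and> multipliers = sq_order m"
proof -
  define N where "N = {q. \<exists>p. sq_poly p + sq_poly q * indet \<in> multipliers}"
  have N: "q \<in> N \<longleftrightarrow> sq_poly q * indet \<in> multipliers" for q
  proof
    assume "q \<in> N"
    then obtain p where "sq_poly p + sq_poly q * indet \<in> multipliers" by (auto simp: N_def)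
    from M.diff_mem[OF this sq_poly_in_multipliers[of p]] show "sq_poly q * indet \<in> multipliers" by simp
  next
    assume "sq_poly q * indet \<in> multipliers"
    then have "sq_poly 0 + sq_poly q * indet \<in> multipliers" by simp
    then show "q \<in> N" unfolding N_def by blast
  qed
  obtain d where d: "d \<in> N" "\<And>p. p \<in> N \<Longrightarrow> d dvd p"
  proof (rule poly_ideal_principal[of N])
    show "p * q \<in> N" if "q \<in> N" for p q
      using that M.mult_mem[OF sq_poly_in_multipliers[of p], of "sq_poly q * indet"]
      by (simp add: N mult.assoc)
  qed (auto simp: N M.zero_mem distrib_right M.add_mem)
  have "(indet :: 'a poly fract) ^ n = sq_poly ([:0, 1:] ^ (n div 2)) * indet"
    by (rule indet_power_odd[OF odd_n])
  moreover have "indet ^ n \<in> multipliers"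
    using sq_order_subset_multipliers odd_n by (auto intro: indet_power_in_sq_order)
  ultimately have n: "[:0, 1:] ^ (n div 2) \<in> N" unfolding N by metis
  then obtain c j where c: "c \<noteq> 0" "d = smult c ([:0, 1:] ^ j)" using d(2) dvd_X_power by metis
  have X: "[:0, 1:] ^ j dvd q" if "q \<in> N" for q
    using d(2)[OF that] c by (simp add: smult_dvd_iff)
  have "degree ([:0, 1::'a:] ^ j) \<le> degree ([:0, 1::'a:] ^ (n div 2))"
    using X[OF n] by (rule dvd_imp_degree_le) auto
  then have "j \<le> n div 2" by (simp add: degree_power_eq)
  then have le: "2 * j + 1 \<le> n" using odd_n by (auto elim!: oddE)
  have ij: "(indet :: 'a poly fract) ^ (2 * j + 1) = sq_poly ([:0, 1:] ^ j) * indet"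
    using indet_power_odd[of "2 * j + 1", where 'a = 'a] by simp
  \<comment> \<open>The generator is a power of the indeterminate only up to the unit
    \<open>c\<close>, which is divided out inside the multiplier ring.\<close>
  have "[:inverse c:] * d = [:0, 1:] ^ j" using c by simp
  moreover have "sq_poly ([:inverse c:] * d) * indet \<in> multipliers"
    using M.mult_mem[OF sq_poly_in_multipliers[of "[:inverse c:]"], of "sq_poly d * indet"] d(1)
    by (simp only: N sq_poly_mult mult.assoc)
  ultimately have xj: "indet ^ (2 * j + 1) \<in> multipliers" unfolding ij by metis
  have "multipliers = sq_order (2 * j + 1)"
  proof (intro equalityI subsetI)
    fix y assume y: "y \<in> multipliers"
    then obtain a b where ab: "y = sq_poly a + sq_poly b * indet"
      using multipliers_integral unfolding sq_order_def by auto
    with y have "b \<in> N" unfolding N_def by blast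
    then obtain b' where b': "b = [:0, 1:] ^ j * b'" using X by (auto elim: dvdE)
    have "y = sq_poly a + sq_poly b' * indet ^ (2 * j + 1)"
      unfolding ij by (simp add: ab b' mult_ac)
    then show "y \<in> sq_order (2 * j + 1)" by (simp only: sq_orderI)
  next
    fix y :: "'a poly fract" assume "y \<in> sq_order (2 * j + 1)"
    then obtain a b where "y = sq_poly a + sq_poly b * indet ^ (2 * j + 1)" unfolding sq_order_def by blast
    then show "y \<in> multipliers"
      using M.add_mem[OF sq_poly_in_multipliers M.mult_mem[OF sq_poly_in_multipliers xj]] by metis
  qed
  with le show ?thesis by (intro exI[of _ "2 * j + 1"]) auto
qed

lemma least_odd_multiplier:
  assumes f: "f = (LEAST m. 0 < m \<and> odd m \<and> (\<forall>y\<in>I. indet ^ m * y \<in> I))"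
  shows "odd f" "f \<le> n" "multipliers = sq_order f"
proof -
  obtain m where m: "odd m" "m \<le> n" "multipliers = sq_order m" using multipliers_eq by blast
  have "(\<forall>y\<in>I. indet ^ k * y \<in> I) \<longleftrightarrow> m \<le> k" if "odd k" for k
    using indet_power_in_sq_order_iff[OF m(1) that, where 'a = 'a] m(3) by (simp add: multipliers_def set_eq_iff)
  then have "f = m"
    unfolding f using m(1) odd_pos by (intro Least_equality) auto
  with m show "odd f" "f \<le> n" "multipliers = sq_order f" by auto
qed

text \<open>x^(n-1) is a common denominator: it lies in \<open>R\<close> because n - 1 is even, and
  it multiplies K[x] into \<open>R\<close>, so every multiplier is a fraction of
  \<open>R\<close>.\<close>

lemma multiplier_ring_eq: "multiplier_ring (sq_order n) I = multipliers"
proof -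
  have "y \<in> fraction_field (sq_order n)" if "y \<in> multipliers" for y
  proof -
    from that multipliers_integral obtain a b where y: "y = sq_poly a + sq_poly b * indet"
      unfolding sq_order_def by auto
    have e: "(indet :: 'a poly fract) ^ (n - 1) = sq_poly ([:0, 1:] ^ ((n - 1) div 2))"
      using odd_n by (intro indet_power_even) auto
    have o: "(indet :: 'a poly fract) ^ n = indet * indet ^ (n - 1)"
      using odd_n by (auto simp: odd_pos simp flip: power_Suc)
    have "y * indet ^ (n - 1) = sq_poly (a * [:0, 1:] ^ ((n - 1) div 2)) + sq_poly b * indet ^ n"
      by (simp only: y o e sq_poly_mult) (simp add: algebra_simps)
    then have "y * indet ^ (n - 1) \<in> sq_order n" by (simp only: sq_orderI)
    moreover have "(indet :: 'a poly fract) ^ (n - 1) \<in> sq_order n" unfolding e by (rule sq_poly_in_sq_order)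
    moreover have "y = y * indet ^ (n - 1) / indet ^ (n - 1)" "indet ^ (n - 1) \<noteq> (0 :: 'a poly fract)"
      by auto
    ultimately show ?thesis unfolding fraction_field_def by blast
  qed
  then show ?thesis by (auto simp: multiplier_ring_def multipliers_def)
qed

end

section \<open>The first Fitting ideal, read off from the entries of the relations\<close>

lemma minors_in_1:
  fixes S :: "'i set" and J :: "'r::comm_ring_1 set"
  shows "minors_in J 1 S N \<longleftrightarrow> (\<forall>c\<in>N. \<forall>i\<in>S. c i \<in> J)"
proof -
  have "minor_det 1 w \<rho> = w 0 (\<rho> 0)" for w :: "nat \<Rightarrow> 'i \<Rightarrow> 'r" and \<rho> :: "nat \<Rightarrow> 'i"
    using minor_det_last_row[of 0 w \<rho>] by (simp add: minor_det_def)
  then have "minors_in J 1 S N \<longleftrightarrow>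
      (\<forall>w (\<rho> :: nat \<Rightarrow> 'i). w 0 \<in> N \<longrightarrow> \<rho> 0 \<in> S \<longrightarrow> w (0::nat) (\<rho> 0) \<in> J)"
    by (simp add: minors_in_def)
  also have "\<dots> \<longleftrightarrow> (\<forall>c\<in>N. \<forall>i\<in>S. c i \<in> J)"
  proof (intro iffI ballI)
    fix c i assume "\<forall>w (\<rho> :: nat \<Rightarrow> 'i). w 0 \<in> N \<longrightarrow> \<rho> 0 \<in> S \<longrightarrow> w (0::nat) (\<rho> 0) \<in> J" "c \<in> N" "i \<in> S"
    from this(1)[rule_format, of "\<lambda>_. c" "\<lambda>_. i"] this(2,3) show "c i \<in> J" by simp
  qed auto
  finally show ?thesis .
qed

context sq_order_ideal_basis
begin

interpretation R: unital_subring "sq_order n :: 'a poly fract set"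
  by (rule unital_subring_sq_order)

text \<open>A common factor \<open>d\<close> of \<open>q\<close>, \<open>r\<close> and \<open>p - s\<close> makes \<open>(x\<^sup>f - p) / d\<close> a multiplier.\<close>

lemma multiplier_matrix_primitive:
  assumes f: "odd f" "multipliers = sq_order f"
    and pq: "indet ^ f * e0 = sq_poly p * e0 + sq_poly q * e1"
    and rs: "indet ^ f * e1 = sq_poly r * e0 + sq_poly s * e1"
  obtains a b c where "a * q + b * r + c * (p - s) = 1"
proof -
  define N where "N = {a * q + b * r + c * (p - s) | a b c. True}"
  obtain d where d: "d \<in> N" "\<And>p. p \<in> N \<Longrightarrow> d dvd p"
  proof (rule poly_ideal_principal[of N])
    have "0 = 0 * q + 0 * r + 0 * (p - s)" by simp
    then show "0 \<in> N" unfolding N_def by blast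
    show "u + v \<in> N" if uv: "u \<in> N" "v \<in> N" for u v
    proof -
      from uv obtain a b c a' b' c' where u: "u = a * q + b * r + c * (p - s)"
        and v: "v = a' * q + b' * r + c' * (p - s)" by (auto simp: N_def)
      then have "u + v = (a + a') * q + (b + b') * r + (c + c') * (p - s)"
        by (simp only: u v) (simp add: algebra_simps)
      then show ?thesis unfolding N_def by blast
    qed
    show "u * v \<in> N" if v: "v \<in> N" for u v
    proof -
      from v obtain a b c where v: "v = a * q + b * r + c * (p - s)" by (auto simp: N_def)
      then have "u * v = (u * a) * q + (u * b) * r + (u * c) * (p - s)"
        by (simp only: v) (simp add: algebra_simps)
      then show ?thesis unfolding N_def by blast
    qed
  qed blast
  have "q = 1 * q + 0 * r + 0 * (p - s)" "r = 0 * q + 1 * r + 0 * (p - s)"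
    "p - s = 0 * q + 0 * r + 1 * (p - s)" by simp_all
  then have "q \<in> N" "r \<in> N" "p - s \<in> N" unfolding N_def by blast+
  then have "d dvd q" "d dvd r" "d dvd p - s" using d(2) by blast+
  then obtain q' r' m' where q': "q = d * q'" and r': "r = d * r'" and m': "p - s = d * m'"
    unfolding dvd_def by blast
  have s: "s = p - d * m'" using m' by (simp add: algebra_simps)
  \<comment> \<open>With \<open>d\<close> equal to 0 the entry \<open>q\<close> vanishes, and x^f
    acts on \<open>e0\<close> as \<open>p\<close>; then x^f would lie in A.\<close>
  have "d \<noteq> 0"
  proof
    assume "d = 0"
    then have "(indet ^ f - sq_poly p) * e0 = 0" using pq by (simp add: q' algebra_simps)
    then have "sq_poly p + sq_poly (- 1) * indet ^ f = 0" using e0_nonzero by simp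
    from sq_poly_decomposition_odd_zero[OF f(1) this] show False by simp
  qed
  define z where "z = (indet ^ f - sq_poly p) / sq_poly d"
  have z: "sq_poly d * z = indet ^ f - sq_poly p" using \<open>d \<noteq> 0\<close> by (simp add: z_def)
  have "sq_poly d * (z * e0) = sq_poly d * (sq_poly q' * e1)"
    using pq by (simp add: mult.assoc[symmetric] z) (simp add: q' algebra_simps)
  then have ze0: "z * e0 = sq_poly q' * e1" using \<open>d \<noteq> 0\<close> by simp
  have "sq_poly d * (z * e1) = sq_poly d * (sq_poly r' * e0 - sq_poly m' * e1)"
    using rs by (simp add: mult.assoc[symmetric] z) (simp add: r' s algebra_simps)
  then have ze1: "z * e1 = sq_poly r' * e0 - sq_poly m' * e1" using \<open>d \<noteq> 0\<close> by simp
  have "z \<in> multipliers"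
    by (rule multipliersI) (simp_all add: ze0 ze1 I_sq_poly_mult I_diff e0 e1)
  then obtain u v where "z = sq_poly u + sq_poly v * indet ^ f"
    unfolding f(2) by (auto simp: sq_order_def)
  with z have "sq_poly (d * u) + sq_poly (d * v) * indet ^ f = sq_poly (- p) + sq_poly 1 * indet ^ f"
    by (simp add: algebra_simps)
  \<comment> \<open>Comparing coefficients of x^f in d z = x^f - p shows that the common factor is a
    unit.\<close>
  then have "d * v = 1" by (rule sq_poly_decomposition_unique(2)[OF f(1)])
  moreover from d(1) obtain a b c where abc: "d = a * q + b * r + c * (p - s)" by (auto simp: N_def)
  then have "d * v = (a * v) * q + (b * v) * r + (c * v) * (p - s)"
    by (simp only: abc) (simp add: algebra_simps)
  ultimately show ?thesis using that by metis
qed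

lemma spans_basis: "R.spans 2 (\<lambda>i. if i = 0 then e0 else e1) I"
  unfolding R.spans_def
proof (intro conjI ballI)
  fix z assume "z \<in> I"
  then obtain a b where "z = sq_poly a * e0 + sq_poly b * e1" using span by blast
  then show "\<exists>C. (\<forall>i. C i \<in> sq_order n) \<and> z = (\<Sum>i<2. C (i::nat) * (if i = 0 then e0 else e1))"
    by (intro exI[of _ "\<lambda>i. if i = 0 then sq_poly a else sq_poly b"])
      (auto simp: numeral_2_eq_2 sq_poly_in_sq_order)
qed (use e0 e1 in auto)

lemma fitting_ideal_eq_conductor:
  assumes f: "odd f" "f \<le> n" "multipliers = sq_order f"
  shows "fitting_ideal (sq_order n) 1 (submodule_on I) = conductor (sq_order n) (sq_order f)"
proof (rule R.fitting_ideal_eqI[OF ideal_I _ spans_basis])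
  let ?F = "conductor (sq_order n) (sq_order f) :: 'a poly fract set"
  let ?y = "indet ^ f :: 'a poly fract"
  note F = conductor_sq_order_iff[OF odd_n f(1,2), where ?'a = 'a]
  show "ideal ?F (ring_on (sq_order n))"
    unfolding R.ideal_ring_on_iff
    by (auto simp: F distrib_right mult.assoc intro: R.ring_closed)
  show "1 \<le> g'" if "R.spans g' e' I" for g' e'
  proof (rule ccontr)
    assume "\<not> 1 \<le> g'"
    then have "g' = 0" by simp
    then have "I \<subseteq> {0}" using that by (auto simp: R.spans_def)
    then show False using nonzero I_zero by blast
  qed
  have "?y \<in> multipliers" using f indet_power_in_sq_order[of f f] by simp
  then obtain p q r s where pq: "?y * e0 = sq_poly p * e0 + sq_poly q * e1"
    and rs: "?y * e1 = sq_poly r * e0 + sq_poly s * e1" by (rule multipliers_matrix)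
  obtain \<alpha> \<beta> \<gamma> where bezout: "\<alpha> * q + \<beta> * r + \<gamma> * (p - s) = 1"
    using multiplier_matrix_primitive[OF f(1,3) pq rs] .
  note R_sq = sq_poly_in_sq_order[of _ n, where 'a = 'a]
  fix J :: "'a poly fract set" assume J: "ideal J (ring_on (sq_order n))"
  let ?e = "\<lambda>i::nat. if i = 0 then e0 else e1"
  have "(\<forall>c\<in>R.rel {..<2} ?e. \<forall>i\<in>{..<2}. c i \<in> J) \<longleftrightarrow> ?F \<subseteq> J"
  proof
    assume *: "\<forall>c\<in>R.rel {..<2} ?e. \<forall>i\<in>{..<2}. c i \<in> J"
    have rel: "u \<in> J \<and> v \<in> J" if "u \<in> sq_order n" "v \<in> sq_order n" "u * e0 + v * e1 = 0" for u v
    proof -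
      have "(\<lambda>i::nat. if i = 0 then u else v) \<in> R.rel {..<2} ?e"
        using that by (auto simp: R.rel_def numeral_2_eq_2)
      from bspec[OF * this] show ?thesis by (force simp: numeral_2_eq_2)
    qed
    show "?F \<subseteq> J"
    proof
      fix c assume "c \<in> ?F"
      then have c: "c \<in> sq_order n" "c * ?y \<in> sq_order n" by (auto simp: F)
      have "c * ?y * e0 = c * (?y * e0)" "c * ?y * e1 = c * (?y * e1)" by simp_all
      then have "(c * ?y - c * sq_poly p) * e0 + (- (c * sq_poly q)) * e1 = 0"
        "(- (c * sq_poly r)) * e0 + (c * ?y - c * sq_poly s) * e1 = 0"
        unfolding pq rs by (simp_all add: algebra_simps)
      then have J1: "c * ?y - c * sq_poly p \<in> J" "- (c * sq_poly q) \<in> J"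
        "- (c * sq_poly r) \<in> J" "c * ?y - c * sq_poly s \<in> J"
        using rel c R_sq by (meson R.diff_mem R.mult_mem R.uminus_mem)+
      \<comment> \<open>The Bezout identity times \<open>c\<close>. The off-diagonal terms are
        entries of the two relations, and c (p - s) is the difference of their diagonal entries, in
        which c x^f cancels.\<close>
      have "c = sq_poly (- \<alpha>) * (- (c * sq_poly q)) + sq_poly (- \<beta>) * (- (c * sq_poly r)) +
          sq_poly \<gamma> * ((c * ?y - c * sq_poly s) - (c * ?y - c * sq_poly p))"
      proof -
        have "c = c * sq_poly (\<alpha> * q + \<beta> * r + \<gamma> * (p - s))" by (simp only: bezout) simp
        then show ?thesis by (simp add: algebra_simps)
      qed
      also have "\<dots> \<in> J"
        by (intro R.ideal_add[OF J] R.ideal_mult[OF J] R.ideal_diff[OF J] R_sq J1)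
      finally show "c \<in> J" .
    qed
  next
    assume FJ: "?F \<subseteq> J"
    show "\<forall>c\<in>R.rel {..<2} ?e. \<forall>i\<in>{..<2}. c i \<in> J"
    proof (intro ballI)
      fix c i assume c: "c \<in> R.rel {..<2} ?e" and i: "i \<in> {..<2::nat}"
      define u v where "u = c 0" and "v = c 1"
      have uv: "u \<in> sq_order n" "v \<in> sq_order n" and rel: "u * e0 + v * e1 = 0"
        using c by (auto simp: R.rel_def u_def v_def numeral_2_eq_2)
      have y: "u * (?y * e0) + v * (?y * e1) = 0"
        using arg_cong[OF rel, of "(*) ?y"] by (simp add: algebra_simps)
      \<comment> \<open>Subtracting \<open>p\<close> times the relation from x^f times the relation
        removes \<open>e0\<close> and leaves a multiple of \<open>e1\<close>. The companion equation
        below uses \<open>s\<close> to remove \<open>e1\<close>.\<close>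
      have "(v * ?y - (sq_poly p * v - sq_poly q * u)) * e1 =
          u * (sq_poly p * e0 + sq_poly q * e1) + v * (?y * e1) - sq_poly p * (u * e0 + v * e1)"
        by (simp add: algebra_simps)
      also have "\<dots> = 0" using y unfolding pq rel by simp
      finally have v: "v * ?y = sq_poly p * v - sq_poly q * u" using e1_nonzero by simp
      have "(u * ?y - (sq_poly s * u - sq_poly r * v)) * e0 =
          u * (?y * e0) + v * (sq_poly r * e0 + sq_poly s * e1) - sq_poly s * (u * e0 + v * e1)"
        by (simp add: algebra_simps)
      also have "\<dots> = 0" using y unfolding rs rel by simp
      finally have u: "u * ?y = sq_poly s * u - sq_poly r * v" using e0_nonzero by simp
      have "u \<in> ?F" "v \<in> ?F"
        using uv by (simp_all add: F u v R.diff_mem R.mult_mem R_sq)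
      moreover have "i = 0 \<or> i = 1" using i by auto
      ultimately show "c i \<in> J" using FJ by (auto simp: u_def v_def)
    qed
  qed
  then show "minors_in J (2 - 1) {..<2} (R.rel {..<2} ?e) \<longleftrightarrow> ?F \<subseteq> J"
    by (simp only: minors_in_1 diff_numeral_special one_add_one[symmetric] add_diff_cancel_right')
qed

end

section \<open>The quotient by the conductor\<close>

lemma (in unital_subring) a_minus_ring_on:
  assumes "a \<in> R" "b \<in> R"
  shows "a \<ominus>\<^bsub>ring_on R\<^esub> b = a - b"
proof -
  interpret cring "ring_on R" by (rule cring_ring_on)
  have "\<ominus>\<^bsub>ring_on R\<^esub> b = - b" using assms by (intro minus_equality) (auto simp: uminus_mem)
  then show ?thesis by (simp add: a_minus_def)
qed

text \<open>Taking the even part modulo x^(n-f) is a surjective homomorphism. Its kernel is the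
  conductor, because in the explicit form of the conductor divisibility by x^(n-f) is imposed on the
  even part alone.\<close>

lemma sq_order_quotient_iso:
  assumes n: "odd n" "odd f" "f \<le> n"
  shows "ring_on (sq_order n :: 'a::field poly fract set) Quot conductor (sq_order n) (sq_order f) \<simeq>
    ring_on (range sq_poly) Quot {a * indet ^ (n - f) | a :: 'a poly fract. a \<in> range sq_poly}"
proof -
  define A where "A = range (sq_poly :: 'a poly \<Rightarrow> _)"
  define U where "U = {a * indet ^ (n - f) | a :: 'a poly fract. a \<in> A}"
  interpret R: unital_subring "sq_order n :: 'a poly fract set" by (rule unital_subring_sq_order)
  interpret A: unital_subring A unfolding A_def by (rule unital_subring_range_sq_poly)
  have nf: "(indet :: 'a poly fract) ^ (n - f) \<in> A"
    using n indet_power_even[of "n - f", where 'a = 'a] by (auto simp: A_def simp del: sq_poly_power)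
  have U: "ideal U (ring_on A)"
    unfolding A.ideal_ring_on_iff
  proof (intro conjI ballI)
    show "U \<subseteq> A" using nf by (auto simp: U_def intro: A.mult_mem)
    show "0 \<in> U" using A.zero_mem by (force simp: U_def)
    show "a + b \<in> U" if "a \<in> U" "b \<in> U" for a b
      using that A.add_mem unfolding U_def by (force simp: distrib_right[symmetric])
    show "r * a \<in> U" if "r \<in> A" "a \<in> U" for r a
      using that A.mult_mem unfolding U_def by (force simp: mult.assoc[symmetric])
  qed
  interpret U: ideal U "ring_on A" by (rule U)
  define ev where "ev y = (SOME a. a \<in> A \<and> (\<exists>b. y = a + sq_poly b * indet ^ n))" for y :: "'a poly fract"
  have ev: "ev (sq_poly a + sq_poly b * indet ^ n) = sq_poly a" for a b
    unfolding ev_def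
    by (rule some_equality) (auto simp: A_def dest: sq_poly_decomposition_unique[OF n(1)])
  have ev_mem: "ev y \<in> A" if "y \<in> sq_order n" for y
    using that by (auto simp: sq_order_def ev A_def)
  define h where "h y = U +>\<^bsub>ring_on A\<^esub> ev y" for y
  have coset_eq: "U +>\<^bsub>ring_on A\<^esub> a = U +>\<^bsub>ring_on A\<^esub> b \<longleftrightarrow> a - b \<in> U" if "a \<in> A" "b \<in> A" for a b
    using U.quotient_eq_iff_same_a_r_cos[OF U, of a b] that by (simp add: A.a_minus_ring_on)
  have hom: "h \<in> Ring.ring_hom (ring_on (sq_order n)) (ring_on A Quot U)"
  proof (rule ring_hom_memI)
    note q = U.rcos_ring_hom
    show "h y \<in> carrier (ring_on A Quot U)" if "y \<in> carrier (ring_on (sq_order n))" for y :: "'a poly fract"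
      using ring_hom_closed[OF q, of "ev y"] that ev_mem by (simp add: h_def)
    show "h \<one>\<^bsub>ring_on (sq_order n)\<^esub> = \<one>\<^bsub>ring_on A Quot U\<^esub>"
      using ring_hom_one[OF q] ev[of 1 0] by (simp add: h_def)
    fix y z :: "'a poly fract" assume "y \<in> carrier (ring_on (sq_order n))" "z \<in> carrier (ring_on (sq_order n))"
    then obtain a b c d where y: "y = sq_poly a + sq_poly b * indet ^ n"
      and z: "z = sq_poly c + sq_poly d * indet ^ n"
      by (auto simp: sq_order_def)
    have mem: "sq_poly u \<in> A" for u by (simp add: A_def)
    have "y + z = sq_poly (a + c) + sq_poly (b + d) * indet ^ n" by (simp add: y z algebra_simps)
    then have "ev (y + z) = sq_poly (a + c)" by (simp only: ev)
    then have "ev (y + z) = ev y + ev z" by (simp add: y z ev)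
    then show "h (y \<oplus>\<^bsub>ring_on (sq_order n)\<^esub> z) = h y \<oplus>\<^bsub>ring_on A Quot U\<^esub> h z"
      using ring_hom_add[OF q, of "ev y" "ev z"] \<open>ev (y + z) = ev y + ev z\<close>
      by (simp add: h_def) (simp add: y z ev mem)
    have nn: "(indet :: 'a poly fract) ^ n * indet ^ n = sq_poly ([:0, 1:] ^ n)"
      by (simp add: sq_poly_X flip: power_mult power_add mult_2)
    have "y * z = sq_poly (a * c + b * d * [:0, 1:] ^ n) + sq_poly (a * d + b * c) * indet ^ n"
      by (simp only: y z sq_poly_add sq_poly_mult nn[symmetric]) (simp add: algebra_simps)
    then have evm: "ev (y * z) = sq_poly (a * c + b * d * [:0, 1:] ^ n)"
      using ev[of "a * c + b * d * [:0, 1:] ^ n" "a * d + b * c"] by (simp only:)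
    \<comment> \<open>Here \<open>ev\<close> fails to be multiplicative only by b d x^(2n).
      Splitting off x^(n-f) leaves x^(n+f), an even power, so the defect lies in
      \<open>U\<close>.\<close>
    have "indet ^ n * indet ^ n = (indet :: 'a poly fract) ^ (n + f) * indet ^ (n - f)"
      using n by (simp flip: power_add)
    moreover have "(indet :: 'a poly fract) ^ (n + f) = sq_poly ([:0, 1:] ^ ((n + f) div 2))"
      using n by (intro indet_power_even) auto
    ultimately have "ev (y * z) - ev y * ev z =
        sq_poly (b * d * [:0, 1:] ^ ((n + f) div 2)) * indet ^ (n - f)"
      unfolding evm by (simp add: y z ev nn[simplified, symmetric] mult.assoc)
    then have "ev (y * z) - ev y * ev z \<in> U" unfolding U_def A_def by blast
    then have "h (y * z) = U +>\<^bsub>ring_on A\<^esub> (ev y * ev z)"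
      unfolding h_def by (subst coset_eq) (simp_all only: evm mem, simp add: y z ev A.mult_mem mem)
    then show "h (y \<otimes>\<^bsub>ring_on (sq_order n)\<^esub> z) = h y \<otimes>\<^bsub>ring_on A Quot U\<^esub> h z"
      using ring_hom_mult[OF q, of "ev y" "ev z"] by (simp add: h_def y z ev mem)
  qed
  interpret h: ring_hom_ring "ring_on (sq_order n)" "ring_on A Quot U" h
    by (intro ring_hom_ringI2 cring.axioms(1)[OF R.cring_ring_on] U.quotient_is_ring hom)
  have "h ` carrier (ring_on (sq_order n)) = carrier (ring_on A Quot U)"
  proof
    show "carrier (ring_on A Quot U) \<subseteq> h ` carrier (ring_on (sq_order n))"
    proof
      fix c assume "c \<in> carrier (ring_on A Quot U)"
      then obtain a where "c = U +>\<^bsub>ring_on A\<^esub> sq_poly a"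
        by (auto simp: FactRing_def A_RCOSETS_def' A_def)
      then have "c = h (sq_poly a)" using ev[of a 0] by (simp add: h_def)
      then show "c \<in> h ` carrier (ring_on (sq_order n))" by (auto simp: sq_poly_in_sq_order)
    qed
  qed (use ring_hom_closed[OF hom] in blast)
  from h.FactRing_iso[OF this]
  have "ring_on (sq_order n) Quot a_kernel (ring_on (sq_order n)) (ring_on A Quot U) h \<simeq> ring_on A Quot U" .
  moreover have "a_kernel (ring_on (sq_order n)) (ring_on A Quot U) h = conductor (sq_order n) (sq_order f)"
  proof -
    have "h y = \<zero>\<^bsub>ring_on A Quot U\<^esub> \<longleftrightarrow> ev y \<in> U" if "y \<in> sq_order n" for y
      using coset_eq[OF ev_mem[OF that] A.zero_mem] ring_hom_zero[OF U.rcos_ring_hom cring.axioms(1)[OF A.cring_ring_on] U.quotient_is_ring]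
      by (simp add: h_def)
    then have "a_kernel (ring_on (sq_order n)) (ring_on A Quot U) h = {y \<in> sq_order n. ev y \<in> U}"
      unfolding a_kernel_def' R.ring_on_simps(1) by blast
    also have "\<dots> = conductor (sq_order n) (sq_order f)"
      unfolding conductor_sq_order_decompose[OF n]
    proof (intro equalityI subsetI)
      fix y :: "'a poly fract" assume "y \<in> {y \<in> sq_order n. ev y \<in> U}"
      then show "y \<in> {sq_poly a * indet ^ (n - f) + sq_poly b * indet ^ n | a b. True}"
        by (auto simp: sq_order_def ev U_def A_def) blast
    next
      fix y :: "'a poly fract"
      assume "y \<in> {sq_poly a * indet ^ (n - f) + sq_poly b * indet ^ n | a b. True}"
      then obtain a b where y: "y = sq_poly a * indet ^ (n - f) + sq_poly b * indet ^ n" by blast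
      from nf obtain c where c: "(indet :: 'a poly fract) ^ (n - f) = sq_poly c" by (auto simp: A_def)
      have "y = sq_poly (a * c) + sq_poly b * indet ^ n" by (simp add: y c)
      then have "y \<in> sq_order n" "ev y = sq_poly a * indet ^ (n - f)"
        using ev[of "a * c" b] sq_orderI[of "a * c" b n] by (simp_all add: c)
      then show "y \<in> {y \<in> sq_order n. ev y \<in> U}" by (auto simp: U_def A_def)
    qed
    finally show ?thesis .
  qed
  ultimately show ?thesis unfolding U_def A_def by simp
qed

section \<open>The action of the special linear group on generating tuples\<close>

lemma row_vec_mult_index:
  assumes "A \<in> carrier_mat k k" "v \<in> carrier_vec k" "j < k"
  shows "row_vec_mult v A $ j = (\<Sum>i<k. v $ i * A $$ (i, j))"
  using assms by (auto simp: row_vec_mult_def scalar_prod_def lessThan_atLeast0 intro!: sum.cong)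

lemma row_vec_mult_carrier:
  "A \<in> carrier_mat k k \<Longrightarrow> row_vec_mult v A \<in> carrier_vec k"
  by (auto simp: row_vec_mult_def)

text \<open>Turns the right action on rows into multiplication of columns from the left, from which
  the action laws are inherited.\<close>

lemma row_vec_mult_transpose:
  assumes "A \<in> carrier_mat k k" "v \<in> carrier_vec k"
  shows "row_vec_mult v A = transpose_mat A *\<^sub>v v"
  using assms by (auto simp: row_vec_mult_def mult_mat_vec_def intro!: eq_vecI comm_scalar_prod)

lemma row_vec_mult_one: "v \<in> carrier_vec k \<Longrightarrow> row_vec_mult v (1\<^sub>m k) = v"
  by (simp add: row_vec_mult_transpose[of _ k])

lemma row_vec_mult_assoc:
  assumes "A \<in> carrier_mat k k" "B \<in> carrier_mat k k" "v \<in> carrier_vec k"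
  shows "row_vec_mult v (A * B) = row_vec_mult (row_vec_mult v A) B"
  using assms
  by (simp add: row_vec_mult_transpose[of _ k] transpose_mult[of _ k k _ k]
      assoc_mult_mat_vec[of _ k k _ k] transpose_carrier_mat[THEN iffD2] mult_mat_vec_carrier)

section \<open>The special linear group over a subring\<close>

context unital_subring
begin

lemma prod_mem: "(\<And>i. i \<in> S \<Longrightarrow> f i \<in> R) \<Longrightarrow> prod f S \<in> R"
  by (induction S rule: infinite_finite_induct) (auto intro: one_mem mult_mem)

lemma det_mem:
  assumes A: "A \<in> carrier_mat k k" and R: "\<And>i j. i < k \<Longrightarrow> j < k \<Longrightarrow> A $$ (i, j) \<in> R"
  shows "det A \<in> R"
proof -
  have "signof p \<in> R" for p by (simp add: sign_def one_mem uminus_mem)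
  moreover have "p i < k" if "p permutes {0..<k}" "i < k" for p i
    using permutes_in_image[OF that(1), of i] that(2) by simp
  ultimately show ?thesis
    unfolding det_def'[OF A] by (intro sum_mem mult_mem prod_mem R) auto
qed

lemma SL_carrier_iff:
  "A \<in> carrier (SL k R) \<longleftrightarrow>
     A \<in> carrier_mat k k \<and> (\<forall>i<k. \<forall>j<k. A $$ (i, j) \<in> R) \<and> det A = 1"
  unfolding SL_def by (auto simp: subset_iff)

lemma SL_simps [simp]: "A \<otimes>\<^bsub>SL k R\<^esub> B = A * B" "\<one>\<^bsub>SL k R\<^esub> = 1\<^sub>m k"
  by (simp_all add: SL_def)

lemma SL_mult: "A \<in> carrier (SL k R) \<Longrightarrow> B \<in> carrier (SL k R) \<Longrightarrow> A * B \<in> carrier (SL k R)"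
  by (auto simp: SL_carrier_iff det_mult[of _ k] scalar_prod_def intro!: sum_mem mult_mem)

lemma SL_one: "1\<^sub>m k \<in> carrier (SL k R)"
  by (auto simp: SL_carrier_iff one_mem zero_mem)

text \<open>The inverse stays over \<open>R\<close>: the entries of the adjugate are cofactors, and
  with determinant 1 no division occurs.\<close>

lemma SL_adj_mat:
  assumes "A \<in> carrier (SL k R)"
  shows "adj_mat A \<in> carrier (SL k R)" "adj_mat A * A = 1\<^sub>m k" "A * adj_mat A = 1\<^sub>m k"
proof -
  have A: "A \<in> carrier_mat k k" "\<And>i j. i < k \<Longrightarrow> j < k \<Longrightarrow> A $$ (i, j) \<in> R" "det A = 1"
    using assms by (auto simp: SL_carrier_iff)
  note adj = adj_mat[OF A(1)]
  have "1 \<cdot>\<^sub>m 1\<^sub>m k = (1\<^sub>m k :: 'r mat)" by (rule eq_matI) auto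
  with adj A(3) show inv: "adj_mat A * A = 1\<^sub>m k" "A * adj_mat A = 1\<^sub>m k" by simp_all
  have "cofactor A j i \<in> R" if "i < k" "j < k" for i j
  proof -
    from that obtain k' where k': "k = Suc k'" by (cases k) auto
    have "det (mat_delete A j i) \<in> R"
    proof (rule det_mem)
      show "mat_delete A j i \<in> carrier_mat k' k'" using A(1) k' by (auto simp: mat_delete_def)
      show "mat_delete A j i $$ (p, q) \<in> R" if "p < k'" "q < k'" for p q
        using that A(1) k' by (auto simp: mat_delete_def intro!: A(2))
    qed
    then show ?thesis by (auto simp: cofactor_def intro!: ring_closed)
  qed
  then have "adj_mat A $$ (i, j) \<in> R" if "i < k" "j < k" for i j
    using that A(1) by (auto simp: adj_mat_def)
  moreover have "det (adj_mat A) = 1"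
    using det_mult[OF adj(1) A(1)] by (simp add: inv A(3))
  ultimately show "adj_mat A \<in> carrier (SL k R)"
    using adj(1) by (simp add: SL_carrier_iff)
qed

lemma group_SL_opposite: "group (SL k R\<lparr>monoid.mult := \<lambda>a b. b \<otimes>\<^bsub>SL k R\<^esub> a\<rparr>)"
proof (rule groupI, simp_all add: SL_mult SL_one)
  fix A B C assume "A \<in> carrier (SL k R)" "B \<in> carrier (SL k R)" "C \<in> carrier (SL k R)"
  then show "C * (B * A) = C * B * A" by (auto simp: SL_carrier_iff assoc_mult_mat[of _ k k _ k _ k])
next
  fix A assume A: "A \<in> carrier (SL k R)"
  then show "A * 1\<^sub>m k = A" by (auto simp: SL_carrier_iff)
  show "\<exists>B\<in>carrier (SL k R). A * B = 1\<^sub>m k" using SL_adj_mat[OF A] by blast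
qed

lemma generating_tuples_iff:
  assumes M: "ideal M (ring_on R)"
  shows "v \<in> generating_tuples R k M \<longleftrightarrow> v \<in> carrier_vec k \<and> spans k (vec_index v) M"
proof -
  have ideal: "ideal {\<Sum>i<k. C i * v $ i | C. \<forall>i. C i \<in> R} (ring_on R)" (is "ideal ?L _")
    if v: "\<And>i. i < k \<Longrightarrow> v $ i \<in> M"
    unfolding ideal_ring_on_iff
  proof (intro conjI ballI)
    show "?L \<subseteq> R" using v ideal_subset[OF M] by (auto intro!: sum_mem mult_mem)
    show "0 \<in> ?L" by (auto intro!: exI[of _ "\<lambda>_. 0"] simp: zero_mem)
    show "a + b \<in> ?L" if ab: "a \<in> ?L" "b \<in> ?L" for a b
    proof -
      from ab obtain C D where "\<forall>i. C i \<in> R" "\<forall>i. D i \<in> R"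
        "a = (\<Sum>i<k. C i * v $ i)" "b = (\<Sum>i<k. D i * v $ i)" by blast
      then show ?thesis
        by (auto intro!: exI[of _ "\<lambda>i. C i + D i"] simp: add_mem distrib_right sum.distrib)
    qed
    show "r * a \<in> ?L" if ra: "r \<in> R" "a \<in> ?L" for r a
    proof -
      from ra obtain C where "\<forall>i. C i \<in> R" "a = (\<Sum>i<k. C i * v $ i)" by blast
      then show ?thesis using ra(1)
        by (auto intro!: exI[of _ "\<lambda>i. r * C i"] simp: mult_mem sum_distrib_left mult.assoc)
    qed
  qed
  interpret cring "ring_on R" by (rule cring_ring_on)
  show ?thesis
  proof
    assume "v \<in> generating_tuples R k M"
    then have v: "v \<in> carrier_vec k" "\<And>i. i < k \<Longrightarrow> v $ i \<in> M"
      and gen: "genideal (ring_on R) (set\<^sub>v v) = M"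
      by (auto simp: generating_tuples_def vec_set_def)
    have "set\<^sub>v v \<subseteq> {\<Sum>i<k. C i * v $ i | C. \<forall>i. C i \<in> R}"
    proof
      fix x assume "x \<in> set\<^sub>v v"
      then obtain j where j: "j < k" "x = v $ j" using v(1) by (auto simp: vec_set_def)
      then have "x = (\<Sum>i<k. (if i = j then 1 else 0) * v $ i)"
        by (simp add: if_distrib[of "\<lambda>c. c * _"] cong: if_cong)
      then show "x \<in> {\<Sum>i<k. C i * v $ i | C. \<forall>i. C i \<in> R}"
        by (auto intro!: exI[of _ "\<lambda>i. if i = j then 1 else 0"] simp: one_mem zero_mem)
    qed
    from genideal_minimal[OF ideal[OF v(2)] this] gen v
    show "v \<in> carrier_vec k \<and> spans k (vec_index v) M"
      unfolding spans_def by blast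
  next
    assume "v \<in> carrier_vec k \<and> spans k (vec_index v) M"
    then have v: "v \<in> carrier_vec k" "\<And>i. i < k \<Longrightarrow> v $ i \<in> M"
      and sp: "\<And>z. z \<in> M \<Longrightarrow> \<exists>C. (\<forall>i. C i \<in> R) \<and> z = (\<Sum>i<k. C i * v $ i)"
      by (auto simp: spans_def)
    have "genideal (ring_on R) (set\<^sub>v v) = M"
    proof (rule genideal_ring_on_eqI[OF M])
      fix J assume J: "ideal J (ring_on R)"
      show "set\<^sub>v v \<subseteq> J \<longleftrightarrow> M \<subseteq> J"
      proof
        assume *: "set\<^sub>v v \<subseteq> J"
        show "M \<subseteq> J"
        proof
          fix z assume "z \<in> M"
          then obtain C where "\<forall>i. C i \<in> R" "z = (\<Sum>i<k. C i * v $ i)" using sp by blast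
          then show "z \<in> J"
            using * v(1) by (auto simp: vec_set_def intro!: ideal_sum[OF J] ideal_mult[OF J])
        qed
      qed (use v in \<open>auto simp: vec_set_def\<close>)
    qed
    with v show "v \<in> generating_tuples R k M" by (auto simp: generating_tuples_def vec_set_def)
  qed
qed

lemma generating_tuples_row_vec_mult:
  assumes M: "ideal M (ring_on R)" and A: "A \<in> carrier (SL k R)"
    and v: "v \<in> generating_tuples R k M"
  shows "row_vec_mult v A \<in> generating_tuples R k M"
proof -
  note B = SL_adj_mat[OF A]
  have car: "A \<in> carrier_mat k k" "adj_mat A \<in> carrier_mat k k" "v \<in> carrier_vec k"
    and A_R: "\<And>i j. i < k \<Longrightarrow> j < k \<Longrightarrow> A $$ (i, j) \<in> R"
    and B_R: "\<And>i j. i < k \<Longrightarrow> j < k \<Longrightarrow> adj_mat A $$ (i, j) \<in> R"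
    using A B v by (auto simp: SL_carrier_iff generating_tuples_def)
  have sp: "spans k (vec_index v) M" using v by (simp add: generating_tuples_iff[OF M])
  let ?w = "row_vec_mult v A"
  have w: "?w \<in> carrier_vec k" using car by (simp add: row_vec_mult_carrier)
  have "?w $ j \<in> M" if "j < k" for j
    unfolding row_vec_mult_index[OF car(1,3) that]
    using sp A_R that by (intro ideal_sum[OF M], subst mult.commute) (auto simp: spans_def intro!: ideal_mult[OF M])
  moreover have "\<exists>D. (\<forall>i. D i \<in> R) \<and> z = (\<Sum>i<k. D i * ?w $ i)" if "z \<in> M" for z
  proof -
    from sp that obtain C where C: "\<forall>i. C i \<in> R" "z = (\<Sum>i<k. C i * v $ i)"
      by (auto simp: spans_def)
    have "v = row_vec_mult ?w (adj_mat A)"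
      using car B by (simp add: row_vec_mult_assoc[symmetric] row_vec_mult_one)
    then have "v $ i = (\<Sum>j<k. ?w $ j * adj_mat A $$ (j, i))" if "i < k" for i
      using row_vec_mult_index[OF car(2) w that] by simp
    then have "z = (\<Sum>i<k. \<Sum>j<k. C i * (?w $ j * adj_mat A $$ (j, i)))"
      by (simp add: C(2) sum_distrib_left)
    also have "\<dots> = (\<Sum>j<k. (\<Sum>i<k. C i * adj_mat A $$ (j, i)) * ?w $ j)"
      by (subst sum.swap) (simp add: sum_distrib_left sum_distrib_right mult_ac)
    \<comment> \<open>The coefficients are set to 0 beyond \<open>k\<close> because
      \<open>spans\<close> asks for values in \<open>R\<close> at every index.\<close>
    finally have "z = (\<Sum>j<k. (if j < k then \<Sum>i<k. C i * adj_mat A $$ (j, i) else 0) * ?w $ j)"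
      by simp
    moreover have "\<forall>j. (if j < k then \<Sum>i<k. C i * adj_mat A $$ (j, i) else 0) \<in> R"
      using C(1) B_R by (auto intro!: sum_mem mult_mem zero_mem)
    ultimately show ?thesis
      by (intro exI[of _ "\<lambda>j. if j < k then \<Sum>i<k. C i * adj_mat A $$ (j, i) else 0"] conjI)
  qed
  ultimately show ?thesis
    using w by (auto simp: generating_tuples_iff[OF M] spans_def)
qed

lemma transitive_right_action_SL:
  assumes M: "ideal M (ring_on R)"
    and trans: "\<And>v w. v \<in> generating_tuples R k M \<Longrightarrow> w \<in> generating_tuples R k M \<Longrightarrow>
      \<exists>A\<in>carrier (SL k R). w = row_vec_mult v A"
  shows "transitive_right_action (SL k R) (generating_tuples R k M) row_vec_mult"
proof -
  define E where "E = generating_tuples R k M"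
  define G where "G = SL k R\<lparr>monoid.mult := \<lambda>a b. b \<otimes>\<^bsub>SL k R\<^esub> a\<rparr>"
  define act where "act A = (\<lambda>v\<in>E. row_vec_mult v A)" for A :: "'r mat"
  have E: "v \<in> carrier_vec k" "row_vec_mult v A \<in> E" if "v \<in> E" "A \<in> carrier (SL k R)" for v A
    using that generating_tuples_row_vec_mult[OF M] by (auto simp: E_def generating_tuples_def)
  have car: "A \<in> carrier_mat k k" if "A \<in> carrier (SL k R)" for A
    using that by (simp add: SL_carrier_iff)
  have act: "act A \<in> Bij E" if A: "A \<in> carrier (SL k R)" for A
  proof -
    note B = SL_adj_mat[OF A]
    have inverse: "act D (act C v) = v"
      if "v \<in> E" "C \<in> carrier (SL k R)" "D \<in> carrier (SL k R)" "C * D = 1\<^sub>m k" for v C D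
    proof -
      have "act D (act C v) = row_vec_mult v (C * D)"
        using that(1-3) E car by (simp add: act_def row_vec_mult_assoc[of _ k])
      then show ?thesis using that E by (simp add: row_vec_mult_one)
    qed
    have "bij_betw (act A) E E"
    proof (rule bij_betw_byWitness[where f' = "act (adj_mat A)"])
      show "\<forall>v\<in>E. act (adj_mat A) (act A v) = v" "\<forall>v\<in>E. act A (act (adj_mat A) v) = v"
        using A B inverse by blast+
    qed (use A B E in \<open>auto simp: act_def\<close>)
    then show ?thesis by (auto simp: Bij_def act_def)
  qed
  \<comment> \<open>A row acted on by \<open>act B\<close> and then by \<open>act A\<close> is
    multiplied by \<open>B * A\<close>, which is the product of \<open>A\<close> and
    \<open>B\<close> in the opposite group.\<close>
  have "act (B * A) = compose E (act A) (act B)" if "A \<in> carrier (SL k R)" "B \<in> carrier (SL k R)" for A B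
    using that E car by (auto simp: act_def compose_def row_vec_mult_assoc[of _ k] fun_eq_iff)
  then have "act \<in> hom G (BijGroup E)"
    by (auto simp: hom_def BijGroup_def G_def act)
  then have "group_hom G (BijGroup E) act"
    using group_SL_opposite[of k] group_BijGroup
    by (simp add: group_hom_def group_hom_axioms_def G_def)
  then have "transitive_action G E act"
    using trans by (auto simp: transitive_action_def group_action_def transitive_action_axioms_def
        act_def E_def G_def)
  then show ?thesis
    unfolding transitive_right_action_def act_def E_def G_def .
qed

text \<open>The orbit relation on sequences, of which only the first \<open>k\<close> entries count;
  sequences allow entries to be changed by function update.\<close>

definition SL_related :: "nat \<Rightarrow> (nat \<Rightarrow> 'r) \<Rightarrow> (nat \<Rightarrow> 'r) \<Rightarrow> bool" where
  "SL_related k u v \<longleftrightarrow> (\<exists>A\<in>carrier (SL k R). vec k v = row_vec_mult (vec k u) A)"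

lemma SL_related_refl: "SL_related k u u"
  unfolding SL_related_def using SL_one row_vec_mult_one[of "vec k u" k] by force

lemma SL_related_trans: "SL_related k u v \<Longrightarrow> SL_related k v w \<Longrightarrow> SL_related k u w"
proof -
  assume "SL_related k u v" "SL_related k v w"
  then obtain A B where AB: "A \<in> carrier (SL k R)" "B \<in> carrier (SL k R)"
    "vec k v = row_vec_mult (vec k u) A" "vec k w = row_vec_mult (vec k v) B"
    unfolding SL_related_def by blast
  then have "vec k w = row_vec_mult (vec k u) (A * B)"
    by (subst row_vec_mult_assoc[of _ k]) (auto simp: SL_carrier_iff)
  with AB show ?thesis unfolding SL_related_def using SL_mult by blast
qed

lemma SL_related_sym: "SL_related k u v \<Longrightarrow> SL_related k v u"
proof -
  assume "SL_related k u v"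
  then obtain A where A: "A \<in> carrier (SL k R)" "vec k v = row_vec_mult (vec k u) A"
    unfolding SL_related_def by blast
  note B = SL_adj_mat[OF A(1)]
  have "vec k u = row_vec_mult (vec k u) (A * adj_mat A)"
    by (simp add: B row_vec_mult_one)
  also have "\<dots> = row_vec_mult (vec k v) (adj_mat A)"
    using A B by (subst row_vec_mult_assoc[of _ k]) (auto simp: SL_carrier_iff)
  finally show ?thesis using B unfolding SL_related_def by blast
qed

text \<open>Right multiplication by the transvection with entry \<open>r\<close> in position (i, j).
  All later reductions are composed of such moves.\<close>

lemma SL_related_add:
  assumes "i < k" "j < k" "i \<noteq> j" "r \<in> R"
    and w: "\<And>l. l < k \<Longrightarrow> w l = (if l = j then u j + r * u i else u l)"
  shows "SL_related k u w"
proof -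
  let ?A = "addrow_mat k r i j"
  have "?A \<in> carrier (SL k R)"
    using assms by (auto simp: SL_carrier_iff det_addrow_mat one_mem zero_mem add_mem)
  moreover have "vec k w = row_vec_mult (vec k u) ?A"
  proof (rule eq_vecI)
    fix l assume "l < dim_vec (row_vec_mult (vec k u) ?A)"
    then have l: "l < k" by (simp add: row_vec_mult_def)
    have "row_vec_mult (vec k u) ?A $ l = (\<Sum>m<k. u m * ?A $$ (m, l))"
      using l by (subst row_vec_mult_index[of _ k]) auto
    also have "\<dots> = (\<Sum>m<k. (if m = l then u l else 0) + (if m = i then if l = j then r * u i else 0 else 0))"
      using l assms by (intro sum.cong) (auto simp: distrib_left mult.commute)
    also have "\<dots> = w l"
      using l assms(1) by (simp add: sum.distrib w)
    finally show "vec k w $ l = row_vec_mult (vec k u) ?A $ l" using l by simp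
  qed (simp add: row_vec_mult_def)
  ultimately show ?thesis unfolding SL_related_def by blast
qed

lemma spans_SL_related:
  assumes M: "ideal M (ring_on R)" and "SL_related k u v" "spans k u M"
  shows "spans k v M"
proof -
  have spans_vec: "vec k u \<in> generating_tuples R k M \<longleftrightarrow> spans k u M" for u
  proof -
    have "(\<Sum>i<k. C i * vec k u $ i) = (\<Sum>i<k. C i * u i)" for C
      by (intro sum.cong) auto
    then have "spans k (vec_index (vec k u)) M \<longleftrightarrow> spans k u M"
      by (simp add: spans_def)
    then show ?thesis by (simp add: generating_tuples_iff[OF M])
  qed
  from assms(2) obtain A where "A \<in> carrier (SL k R)" "vec k v = row_vec_mult (vec k u) A"
    unfolding SL_related_def by blast
  with generating_tuples_row_vec_mult[OF M, of A k "vec k u"] assms(3) show ?thesis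
    by (metis spans_vec)
qed

end

section \<open>Reduction of generating tuples by division with remainder\<close>

context sq_order_ideal_basis
begin

interpretation R: unital_subring "sq_order n :: 'a poly fract set"
  by (rule unital_subring_sq_order)

definition coord0 :: "'a poly fract \<Rightarrow> 'a poly" where
  "coord0 z = (SOME a. \<exists>b. z = sq_poly a * e0 + sq_poly b * e1)"

definition coord1 :: "'a poly fract \<Rightarrow> 'a poly" where
  "coord1 z = (SOME b. \<exists>a. z = sq_poly a * e0 + sq_poly b * e1)"

lemma coords_combination:
  "coord0 (sq_poly a * e0 + sq_poly b * e1) = a" "coord1 (sq_poly a * e0 + sq_poly b * e1) = b"
  unfolding coord0_def coord1_def
  by (rule some_equality; use coordinates_unique in blast)+

lemma coords: "z \<in> I \<Longrightarrow> z = sq_poly (coord0 z) * e0 + sq_poly (coord1 z) * e1"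
  using span[of z] coords_combination by auto

lemma coords_add_mult:
  assumes "z \<in> I" "z' \<in> I"
  shows "coord0 (z + sq_poly a * z') = coord0 z + a * coord0 z'"
    "coord1 (z + sq_poly a * z') = coord1 z + a * coord1 z'"
proof -
  have "z + sq_poly a * z' = sq_poly (coord0 z + a * coord0 z') * e0 + sq_poly (coord1 z + a * coord1 z') * e1"
    by (subst (1) coords[OF assms(1)], subst (1) coords[OF assms(2)]) (simp add: algebra_simps)
  then show "coord0 (z + sq_poly a * z') = coord0 z + a * coord0 z'"
    "coord1 (z + sq_poly a * z') = coord1 z + a * coord1 z'"
    by (simp_all only: coords_combination)
qed

text \<open>The Euclidean algorithm on the values of an A-linear functional \<open>c\<close>,
  carried out by transvections on the tuple. \<open>N\<close> and \<open>c\<close> are left open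
  because two passes are needed: the second coordinate on \<open>I\<close>, then the first
  coordinate on the part of \<open>I\<close> where the second vanishes.\<close>

lemma euclid_pair:
  assumes N: "\<And>z z' a. z \<in> N \<Longrightarrow> z' \<in> N \<Longrightarrow> z + sq_poly a * z' \<in> N"
    and c: "\<And>z z' a. z \<in> N \<Longrightarrow> z' \<in> N \<Longrightarrow> c (z + sq_poly a * z') = c z + a * c z'"
    and u: "i < k" "j < k" "i \<noteq> j" "u i \<in> N" "u j \<in> N"
  shows "\<exists>w. R.SL_related k u w \<and> w i \<in> N \<and> w j \<in> N \<and> (\<forall>l. l \<noteq> i \<longrightarrow> l \<noteq> j \<longrightarrow> w l = u l) \<and>
    c (w j) = (0 :: 'a poly)"
proof -
  have step: "R.SL_related k u (u(j := u j + sq_poly a * u i))" if "i < k" "j < k" "i \<noteq> j" for u i j a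
    using that by (intro R.SL_related_add[of i k j "sq_poly a"]) (auto simp: sq_poly_in_sq_order)
  \<comment> \<open>The shift puts 0 strictly below the nonzero constants, which have the same
    degree as 0; otherwise the last division would not decrease the measure.\<close>
  define sz where "sz p = (if p = 0 then 0 else Suc (degree p))" for p :: "'a poly"
  have sz_mod: "sz (p mod q) < sz q" if "q \<noteq> 0" for p q
    using degree_mod_less[OF that, of p] that by (auto simp: sz_def)
  have "\<exists>w. R.SL_related k u w \<and> w i \<in> N \<and> w j \<in> N \<and> (\<forall>l. l \<noteq> i \<longrightarrow> l \<noteq> j \<longrightarrow> w l = u l) \<and>
      (c (w i) = 0 \<or> c (w j) = 0)"
    using u
  proof (induction "sz (c (u i)) + sz (c (u j))" arbitrary: u i j rule: less_induct)
    case less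
    have reduce: "\<exists>w. R.SL_related k u w \<and> w i \<in> N \<and> w j \<in> N \<and> (\<forall>l. l \<noteq> i \<longrightarrow> l \<noteq> j \<longrightarrow> w l = u l) \<and>
        (c (w i) = 0 \<or> c (w j) = 0)"
      if ij: "i < k" "j < k" "i \<noteq> j" "u i \<in> N" "u j \<in> N" "c (u j) \<noteq> 0" "sz (c (u j)) \<le> sz (c (u i))"
        and IH: "\<And>v. sz (c (v i)) + sz (c (v j)) < sz (c (u i)) + sz (c (u j)) \<Longrightarrow> v i \<in> N \<Longrightarrow> v j \<in> N \<Longrightarrow>
          \<exists>w. R.SL_related k v w \<and> w i \<in> N \<and> w j \<in> N \<and> (\<forall>l. l \<noteq> i \<longrightarrow> l \<noteq> j \<longrightarrow> w l = v l) \<and>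
          (c (w i) = 0 \<or> c (w j) = 0)"
      for i j
    proof -
      define q where "q = c (u i) div c (u j)"
      define v where "v = u(i := u i + sq_poly (- q) * u j)"
      have "c (v i) = c (u i) + (- q) * c (u j)"
        using c[OF ij(4,5), of "- q"] by (simp add: v_def)
      then have "c (v i) = c (u i) mod c (u j)"
        by (simp add: q_def minus_div_mult_eq_mod[symmetric])
      then have "sz (c (v i)) + sz (c (v j)) < sz (c (u i)) + sz (c (u j))"
        using sz_mod[OF ij(6), of "c (u i)"] ij(3,7) by (simp add: v_def)
      moreover have "v i \<in> N" "v j \<in> N" using ij N[OF ij(4,5), of "- q"] by (auto simp: v_def)
      ultimately obtain w where w: "R.SL_related k v w" "w i \<in> N" "w j \<in> N"
        "\<forall>l. l \<noteq> i \<longrightarrow> l \<noteq> j \<longrightarrow> w l = v l" "c (w i) = 0 \<or> c (w j) = 0" using IH by blast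
      moreover have "R.SL_related k u v" unfolding v_def using ij by (intro step) auto
      ultimately show ?thesis
        using R.SL_related_trans by (intro exI[of _ w]) (auto simp: v_def)
    qed
    consider "c (u i) = 0 \<or> c (u j) = 0" | "c (u j) \<noteq> 0" "sz (c (u j)) \<le> sz (c (u i))"
      | "c (u i) \<noteq> 0" "sz (c (u i)) \<le> sz (c (u j))" by linarith
    then show ?case
    proof cases
      case 1
      then show ?thesis using less.prems R.SL_related_refl by blast
    next
      case 2
      show ?thesis
      proof (rule reduce[OF less.prems 2])
        fix v assume m: "sz (c (v i)) + sz (c (v j)) < sz (c (u i)) + sz (c (u j))"
          and v: "v i \<in> N" "v j \<in> N"
        show "\<exists>w. R.SL_related k v w \<and> w i \<in> N \<and> w j \<in> N \<and> (\<forall>l. l \<noteq> i \<longrightarrow> l \<noteq> j \<longrightarrow> w l = v l) \<and>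
            (c (w i) = 0 \<or> c (w j) = 0)"
          by (rule less.hyps[OF m less.prems(1-3) v])
      qed
    next
      case 3
      have "\<exists>w. R.SL_related k u w \<and> w j \<in> N \<and> w i \<in> N \<and> (\<forall>l. l \<noteq> j \<longrightarrow> l \<noteq> i \<longrightarrow> w l = u l) \<and>
          (c (w j) = 0 \<or> c (w i) = 0)"
      proof (rule reduce[OF less.prems(2,1) less.prems(3)[symmetric] less.prems(5,4) 3])
        fix v assume m: "sz (c (v j)) + sz (c (v i)) < sz (c (u j)) + sz (c (u i))"
          and v: "v j \<in> N" "v i \<in> N"
        show "\<exists>w. R.SL_related k v w \<and> w j \<in> N \<and> w i \<in> N \<and> (\<forall>l. l \<noteq> j \<longrightarrow> l \<noteq> i \<longrightarrow> w l = v l) \<and>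
            (c (w j) = 0 \<or> c (w i) = 0)"
          by (rule less.hyps[OF m[unfolded add.commute[of "sz (c (u j))"]]
                less.prems(2,1) less.prems(3)[symmetric] v])
      qed
      then show ?thesis by blast
    qed
  qed
  then obtain w where w: "R.SL_related k u w" "w i \<in> N" "w j \<in> N"
    "\<forall>l. l \<noteq> i \<longrightarrow> l \<noteq> j \<longrightarrow> w l = u l" "c (w i) = 0 \<or> c (w j) = 0" by blast
  show ?thesis
  proof (cases "c (w j) = 0")
    case True
    with w show ?thesis by blast
  next
    case False
    \<comment> \<open>The value at \<open>i\<close> is the one that vanishes. Adding entry
      \<open>j\<close> to entry \<open>i\<close> makes the two values equal, and subtracting back
      clears the value at \<open>j\<close>.\<close>
    define v where "v = w(i := w i + sq_poly 1 * w j)"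
    define v' where "v' = v(j := v j + sq_poly (- 1) * v i)"
    have v: "v i \<in> N" "v j \<in> N" "c (v i) = c (v j)"
      using N[OF w(2,3), of 1] c[OF w(2,3), of 1] w False u(3) by (auto simp: v_def)
    have "v' i \<in> N" "v' j \<in> N" "c (v' j) = 0"
      using N[OF v(2,1), of "- 1"] c[OF v(2,1), of "- 1"] v u(3) by (auto simp: v'_def)
    moreover have "R.SL_related k w v" "R.SL_related k v v'"
      unfolding v_def v'_def using u(1-3) by (intro step; simp)+
    with w(1) have "R.SL_related k u v'" using R.SL_related_trans by blast
    ultimately show ?thesis using w(4) by (intro exI[of _ v']) (auto simp: v_def v'_def)
  qed
qed

text \<open>Entry \<open>i\<close> is the pivot against which the later entries are cleared one
  after another; the entries before it are untouched, so a second pass can preserve the first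
  pivot.\<close>

lemma euclid_tail:
  assumes N: "\<And>z z' a. z \<in> N \<Longrightarrow> z' \<in> N \<Longrightarrow> z + sq_poly a * z' \<in> N"
    and c: "\<And>z z' a. z \<in> N \<Longrightarrow> z' \<in> N \<Longrightarrow> c (z + sq_poly a * z') = c z + a * c z'"
    and u: "i < k" "\<And>l. i \<le> l \<Longrightarrow> l < k \<Longrightarrow> u l \<in> N"
  shows "\<exists>w. R.SL_related k u w \<and> (\<forall>l<i. w l = u l) \<and> (\<forall>l. i \<le> l \<longrightarrow> l < k \<longrightarrow> w l \<in> N) \<and>
    (\<forall>l. i < l \<longrightarrow> l < k \<longrightarrow> c (w l) = (0 :: 'a poly))"
proof -
  have "\<exists>w. R.SL_related k u w \<and> (\<forall>l<i. w l = u l) \<and> (\<forall>l. i \<le> l \<longrightarrow> l < k \<longrightarrow> w l \<in> N) \<and>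
      (\<forall>l. i < l \<longrightarrow> l < m \<longrightarrow> c (w l) = 0)" if "m \<le> k" for m
    using that
  proof (induction m)
    case 0
    then show ?case using u R.SL_related_refl by (intro exI[of _ u]) auto
  next
    case (Suc m)
    then obtain w where w: "R.SL_related k u w" "\<forall>l<i. w l = u l" "\<forall>l. i \<le> l \<longrightarrow> l < k \<longrightarrow> w l \<in> N"
      "\<forall>l. i < l \<longrightarrow> l < m \<longrightarrow> c (w l) = 0" by auto
    show ?case
    proof (cases "i < m")
      case True
      have "\<exists>v. R.SL_related k w v \<and> v i \<in> N \<and> v m \<in> N \<and> (\<forall>l. l \<noteq> i \<longrightarrow> l \<noteq> m \<longrightarrow> v l = w l) \<and>
          c (v m) = 0"
        by (rule euclid_pair[where N = N and c = c]) (use N c True Suc.prems u(1) w(3) in auto)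
      then obtain v where v: "R.SL_related k w v" "v i \<in> N" "v m \<in> N"
        "\<forall>l. l \<noteq> i \<longrightarrow> l \<noteq> m \<longrightarrow> v l = w l" "c (v m) = 0" by blast
      have "v l \<in> N" if "i \<le> l" "l < k" for l
        using v w(3) that by (cases "l = i \<or> l = m") auto
      moreover have "c (v l) = 0" if "i < l" "l < Suc m" for l
        using v w(4) that by (cases "l = m") auto
      moreover have "v l = u l" if "l < i" for l using v w(2) that True by auto
      moreover have "R.SL_related k u v" using w(1) v(1) by (rule R.SL_related_trans)
      ultimately show ?thesis by blast
    next
      case False
      with w show ?thesis by (intro exI[of _ w]) auto
    qed
  qed
  then show ?thesis by blast
qed

definition triple :: "'a poly fract \<Rightarrow> 'a poly fract \<Rightarrow> 'a poly fract \<Rightarrow> nat \<Rightarrow> 'a poly fract" where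
  "triple x y z l = (if l = 0 then x else if l = 1 then y else if l = 2 then z else 0)"

lemma sum_triple:
  assumes "2 < k"
  shows "(\<Sum>l<k. C l * triple x y z l) = C 0 * x + C 1 * y + C 2 * z"
proof -
  have "(\<Sum>l<k. C l * triple x y z l) = (\<Sum>l\<in>{0, 1, 2}. C l * triple x y z l)"
    using assms by (intro sum.mono_neutral_right) (auto simp: triple_def)
  then show ?thesis by (simp add: triple_def add.assoc)
qed

lemma spans_triple:
  assumes "2 < k" "R.spans k (triple x y z) I" "t \<in> I"
  obtains a b c where "a \<in> sq_order n" "b \<in> sq_order n" "c \<in> sq_order n" "t = a * x + b * y + c * z"
  using assms unfolding R.spans_def sum_triple[OF assms(1)] by metis

lemma SL_related_normal_form:
  assumes k: "2 < k" and u: "R.spans k u I"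
  shows "R.SL_related k u (triple 0 e1 e0)"
proof -
  have uI: "u l \<in> I" if "l < k" for l using u that by (auto simp: R.spans_def)
  have "\<exists>w. R.SL_related k u w \<and> (\<forall>l<0. w l = u l) \<and> (\<forall>l. 0 \<le> l \<longrightarrow> l < k \<longrightarrow> w l \<in> I) \<and>
      (\<forall>l. 0 < l \<longrightarrow> l < k \<longrightarrow> coord1 (w l) = 0)"
    by (rule euclid_tail) (use k uI in \<open>auto intro: I_add I_sq_poly_mult coords_add_mult\<close>)
  then obtain w where w: "R.SL_related k u w" "\<And>l. l < k \<Longrightarrow> w l \<in> I"
    "\<And>l. 0 < l \<Longrightarrow> l < k \<Longrightarrow> coord1 (w l) = 0" by auto
  \<comment> \<open>The second pass starts at entry 1 and stays where the second coordinate is 0, so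
    it does not destroy the zeros of the first pass.\<close>
  have "\<exists>v. R.SL_related k w v \<and> (\<forall>l<1. v l = w l) \<and>
      (\<forall>l. 1 \<le> l \<longrightarrow> l < k \<longrightarrow> v l \<in> {z \<in> I. coord1 z = 0}) \<and>
      (\<forall>l. 1 < l \<longrightarrow> l < k \<longrightarrow> coord0 (v l) = 0)"
    by (rule euclid_tail) (use k w in \<open>auto simp: coords_add_mult intro: I_add I_sq_poly_mult\<close>)
  then obtain v where v: "R.SL_related k w v" "v 0 = w 0"
    "\<And>l. 1 \<le> l \<Longrightarrow> l < k \<Longrightarrow> v l \<in> I \<and> coord1 (v l) = 0"
    "\<And>l. 1 < l \<Longrightarrow> l < k \<Longrightarrow> coord0 (v l) = 0" by auto
  define z a where "z = v 0" and "a = coord0 (v 1)"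
  have zI: "z \<in> I" using v w k by (simp add: z_def)
  have "v 1 = sq_poly a * e0"
    using coords[of "v 1"] v(3)[of 1] k by (simp add: a_def)
  moreover have "v l = 0" if "1 < l" "l < k" for l
    using coords[of "v l"] v(3,4)[of l] that by simp
  ultimately have "R.SL_related k v (triple z (sq_poly a * e0) 0)"
    \<comment> \<open>A transvection with coefficient 0 merely exchanges \<open>v\<close> for a
      sequence with the same first \<open>k\<close> entries.\<close>
    using k by (intro R.SL_related_add[of 0 k 1 0]) (auto simp: triple_def z_def R.zero_mem)
  with u w(1) v(1) have u1: "R.SL_related k u (triple z (sq_poly a * e0) 0)"
    using R.SL_related_trans by blast
  \<comment> \<open>The reduced tuple still generates \<open>I\<close>, so \<open>e0\<close> is a
    combination of \<open>z\<close> and \<open>a e0\<close> with coefficients in \<open>R\<close>.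
    Two transvections add up this combination in the free place 2; then \<open>e0\<close> clears
    place 1 and the \<open>e0\<close>-part of \<open>z\<close>.\<close>
  obtain c d d' where cd: "c \<in> sq_order n" "d \<in> sq_order n" "c * z + d * (sq_poly a * e0) + d' * 0 = e0"
    using spans_triple[OF k R.spans_SL_related[OF ideal_I u1 u] e0] by metis
  have step: "R.SL_related k (triple x y t) (triple x' y' t')"
    if "i < 3" "j < 3" "i \<noteq> j" "r \<in> sq_order n"
      "\<And>l. l < 3 \<Longrightarrow> triple x' y' t' l = (if l = j then triple x y t j + r * triple x y t i else triple x y t l)"
    for x y t x' y' t' i j r
  proof (rule R.SL_related_add[of i k j r])
    fix l assume "l < k"
    show "triple x' y' t' l = (if l = j then triple x y t j + r * triple x y t i else triple x y t l)"
      using that by (cases "l < 3") (auto simp: triple_def)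
  qed (use that k in auto)
  define a' b where "a' = coord0 z" and "b = coord1 z"
  have z: "z = sq_poly a' * e0 + sq_poly b * e1" unfolding a'_def b_def by (rule coords[OF zI])
  have "R.SL_related k (triple z (sq_poly a * e0) 0) (triple z (sq_poly a * e0) (c * z))"
    by (rule step[of 0 2 c]) (auto simp: triple_def cd)
  moreover have "R.SL_related k (triple z (sq_poly a * e0) (c * z)) (triple z (sq_poly a * e0) e0)"
    by (rule step[of 1 2 d]) (use cd in \<open>auto simp: triple_def\<close>)
  moreover have "R.SL_related k (triple z (sq_poly a * e0) e0) (triple z 0 e0)"
    by (rule step[of 2 1 "sq_poly (- a)"]) (auto simp: triple_def sq_poly_in_sq_order simp del: sq_poly_uminus, simp)
  moreover have "R.SL_related k (triple z 0 e0) (triple (sq_poly b * e1) 0 e0)"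
    by (rule step[of 2 0 "sq_poly (- a')"])
      (auto simp: triple_def z sq_poly_in_sq_order simp del: sq_poly_uminus, simp)
  ultimately have u2: "R.SL_related k u (triple (sq_poly b * e1) 0 e0)"
    using u1 R.SL_related_trans by meson
  \<comment> \<open>The same argument for \<open>e1\<close>, with place 1 now the free one.
    Afterwards \<open>e1\<close> clears place 0, so the result no longer depends on the
    tuple.\<close>
  obtain c d d' where cd: "c \<in> sq_order n" "d' \<in> sq_order n" "c * (sq_poly b * e1) + d * 0 + d' * e0 = e1"
    using spans_triple[OF k R.spans_SL_related[OF ideal_I u2 u] e1] by metis
  have "R.SL_related k (triple (sq_poly b * e1) 0 e0) (triple (sq_poly b * e1) (c * (sq_poly b * e1)) e0)"
    by (rule step[of 0 1 c]) (auto simp: triple_def cd)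
  moreover have "R.SL_related k (triple (sq_poly b * e1) (c * (sq_poly b * e1)) e0) (triple (sq_poly b * e1) e1 e0)"
    by (rule step[of 2 1 d']) (use cd in \<open>auto simp: triple_def\<close>)
  moreover have "R.SL_related k (triple (sq_poly b * e1) e1 e0) (triple 0 e1 e0)"
    by (rule step[of 1 0 "sq_poly (- b)"]) (auto simp: triple_def sq_poly_in_sq_order simp del: sq_poly_uminus, simp)
  ultimately show ?thesis
    using u2 R.SL_related_trans by meson
qed

lemma SL_transitive:
  assumes "2 < k"
  shows "transitive_right_action (SL k (sq_order n)) (generating_tuples (sq_order n) k I) row_vec_mult"
proof (rule R.transitive_right_action_SL[OF ideal_I])
  fix v w assume v: "v \<in> generating_tuples (sq_order n) k I" and w: "w \<in> generating_tuples (sq_order n) k I"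
  then have "R.SL_related k (vec_index v) (vec_index w)"
    using SL_related_normal_form[OF assms] R.SL_related_sym R.SL_related_trans
    by (meson R.generating_tuples_iff[OF ideal_I])
  moreover have "vec k (vec_index v) = v" "vec k (vec_index w) = w"
    using v w by (auto simp: generating_tuples_def)
  ultimately show "\<exists>A\<in>carrier (SL k (sq_order n)). w = row_vec_mult v A"
    by (simp add: R.SL_related_def)
qed

end

theorem proposition1p5:
  fixes n f :: nat and R I :: "'a::field poly fract set"
  assumes "n \<ge> 3" and "odd n"
    and "R = adjoin {indet ^ 2, indet ^ n}"
    and "ideal I (ring_on R)" and "I \<noteq> {0}"
    and "f = (LEAST m. 0 < m \<and> odd m \<and> (\<forall>y\<in>I. indet ^ m * y \<in> I))"
  shows "multiplier_ring R I =
      {a + b * indet ^ (f - 1) | a b. a \<in> adjoin {indet ^ 2} \<and> b \<in> adjoin {indet}} \<and>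
    fitting_ideal R 1 (submodule_on I) = conductor R (multiplier_ring R I) \<and>
    conductor R (multiplier_ring R I) =
      {a * indet ^ (n - f) + b * indet ^ (n - 1) | a b.
         a \<in> adjoin {indet ^ 2} \<and> b \<in> adjoin {indet}} \<and>
    ring_on R Quot fitting_ideal R 1 (submodule_on I) \<simeq>
      ring_on (adjoin {indet ^ 2}) Quot
        {a * indet ^ (n - f) | a :: 'a poly fract. a \<in> adjoin {indet ^ 2}} \<and>
    (\<forall>k>2. transitive_right_action (SL k R) (generating_tuples R k I) row_vec_mult)"
proof -
  have R: "R = sq_order n" using assms by (simp add: adjoin_indet_sq_odd)
  interpret sq_order_ideal n I
    by (rule sq_order_ideal.intro[OF assms(2) assms(4)[unfolded R] assms(5)])
  obtain e0 e1 where basis: "e0 \<in> I" "e1 \<in> I"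
    "\<And>z. z \<in> I \<Longrightarrow> \<exists>a b. z = sq_poly a * e0 + sq_poly b * e1"
    "\<And>a b. sq_poly a * e0 + sq_poly b * e1 = 0 \<Longrightarrow> a = 0 \<and> b = 0"
    by (rule ex_basis) (rule that)
  interpret sq_order_ideal_basis n I e0 e1
    by (rule sq_order_ideal_basis.intro[OF sq_order_ideal_axioms
          sq_order_ideal_basis_axioms.intro[OF basis]])
  note f = least_odd_multiplier[OF assms(6)]
  have ring: "multiplier_ring R I = sq_order f"
    by (simp add: R multiplier_ring_eq f(3))
  have fitting: "fitting_ideal R 1 (submodule_on I) = conductor R (sq_order f)"
    unfolding R by (rule fitting_ideal_eq_conductor[OF f])
  show ?thesis
    unfolding ring fitting
    using sq_order_conv[OF f(1), where 'a = 'a]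
      conductor_sq_order_conv[OF odd_n f(1,2), where 'a = 'a]
      sq_order_quotient_iso[OF odd_n f(1,2), where 'a = 'a] SL_transitive
    by (simp only: R adjoin_indet_sq) simp
qed

end
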